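(* Let $G$ be a graph on $n$ vertices with weights on its vertices. If the weights are integers, a maximum vertex-weighted triangle of $G$ can be found in $O(n^{(\omega+3)/2}\cdot \log W)$ time, where $W$ is the maximum weight of a triangle. If the weights are reals, a maximum vertex-weighted triangle can be found in $O(n^{(\omega+3)/2}\cdot B)$ time, where $B$ is the maximum number of bits in a weight.
   Context: $\omega$ denotes the exponent of square matrix multiplication ($n\times n$ matrices can be multiplied in $O(n^\omega)$ arithmetic operations). The weight of a triangle is the sum of the weights of its three vertices. *)

theory Defs
  imports Complex_Main
begin

section \<open>Machine model\<close>

text \<open>
  Running times refer to structured programs for a unit-cost random access machine with two kinds
  of data. \<^emph>\<open>Words\<close> are natural numbers, used for control and as addresses. \<^emph>\<open>Values\<close> are
  real numbers, used for vertex weights and matrix entries. There are scalars of both kinds, and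
  arrays of both kinds that are addressed by words; a program mentions finitely many of them.

  The machine has a word length \<open>w\<close>: every word computed by a program must be below \<open>2 ^ w\<close>.
  Similarly, every value computed must lie in a given set \<open>V\<close> of admissible values. A program
  that violates one of the bounds is stuck. The bounds are essential: with unit-cost
  arithmetic on unboundedly long numbers one could pack a whole matrix row into one number.
\<close>

record state =
  word :: "nat \<Rightarrow> nat"
  val :: "nat \<Rightarrow> real"
  word_arr :: "nat \<Rightarrow> nat \<Rightarrow> nat"
  val_arr :: "nat \<Rightarrow> nat \<Rightarrow> real"

datatype wop = WAdd | WSub | WMul | WDiv

datatype vop = VAdd | VSub | VMul

datatype test =
    WLess nat nat
  | VLess nat nat

datatype prog =
    WConst nat nat
  | WOp wop nat nat nat
  | WLoad nat nat nat
  | WStore nat nat nat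
  | VConst nat int
  | VOp vop nat nat nat
  | VHalf nat nat
  | VLoad nat nat nat
  | VStore nat nat nat
  | Seq prog prog
  | Cond test prog prog
  | Loop test prog

text \<open>Subtraction of words is truncated at 0, and division of words rounds down.\<close>

fun word_op :: "wop \<Rightarrow> nat \<Rightarrow> nat \<Rightarrow> nat" where
  "word_op WAdd x y = x + y"
| "word_op WSub x y = x - y"
| "word_op WMul x y = x * y"
| "word_op WDiv x y = x div y"

fun val_op :: "vop \<Rightarrow> real \<Rightarrow> real \<Rightarrow> real" where
  "val_op VAdd x y = x + y"
| "val_op VSub x y = x - y"
| "val_op VMul x y = x * y"

fun holds :: "test \<Rightarrow> state \<Rightarrow> bool" where
  "holds (WLess a b) s \<longleftrightarrow> word s a < word s b"
| "holds (VLess a b) s \<longleftrightarrow> val s a < val s b"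

definition set_word :: "nat \<Rightarrow> nat \<Rightarrow> state \<Rightarrow> state" where
  "set_word d x s = s\<lparr>word := (word s)(d := x)\<rparr>"

definition set_val :: "nat \<Rightarrow> real \<Rightarrow> state \<Rightarrow> state" where
  "set_val d x s = s\<lparr>val := (val s)(d := x)\<rparr>"

definition set_word_arr :: "nat \<Rightarrow> nat \<Rightarrow> nat \<Rightarrow> state \<Rightarrow> state" where
  "set_word_arr A i x s = s\<lparr>word_arr := (word_arr s)(A := (word_arr s A)(i := x))\<rparr>"

definition set_val_arr :: "nat \<Rightarrow> nat \<Rightarrow> real \<Rightarrow> state \<Rightarrow> state" where
  "set_val_arr A i x s = s\<lparr>val_arr := (val_arr s)(A := (val_arr s A)(i := x))\<rparr>"

text \<open>
  \<open>exec w V p s t s'\<close>: on a machine with word length \<open>w\<close> and admissible values \<open>V\<close>, program \<open>p\<close>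
  started in state \<open>s\<close> halts in state \<open>s'\<close> after \<open>t\<close> steps. Each basic instruction and each
  evaluation of a test is one step. In \<open>WLoad d A i\<close> and \<open>WStore A i a\<close> (and likewise for values)
  the array \<open>A\<close> is accessed at the address held by the scalar \<open>i\<close>.
\<close>

inductive exec :: "nat \<Rightarrow> real set \<Rightarrow> prog \<Rightarrow> state \<Rightarrow> nat \<Rightarrow> state \<Rightarrow> bool"
  for w :: nat and V :: "real set" where
  WConst: "k < 2 ^ w \<Longrightarrow> exec w V (WConst d k) s 1 (set_word d k s)"
| WOp: "x = word_op f (word s a) (word s b) \<Longrightarrow> x < 2 ^ w \<Longrightarrow>
    exec w V (WOp f d a b) s 1 (set_word d x s)"
| WLoad: "exec w V (WLoad d A i) s 1 (set_word d (word_arr s A (word s i)) s)"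
| WStore: "exec w V (WStore A i a) s 1 (set_word_arr A (word s i) (word s a) s)"
| VConst: "of_int k \<in> V \<Longrightarrow> exec w V (VConst d k) s 1 (set_val d (of_int k) s)"
| VOp: "x = val_op f (val s a) (val s b) \<Longrightarrow> x \<in> V \<Longrightarrow>
    exec w V (VOp f d a b) s 1 (set_val d x s)"
| VHalf: "x = val s a / 2 \<Longrightarrow> x \<in> V \<Longrightarrow> exec w V (VHalf d a) s 1 (set_val d x s)"
| VLoad: "exec w V (VLoad d A i) s 1 (set_val d (val_arr s A (word s i)) s)"
| VStore: "exec w V (VStore A i a) s 1 (set_val_arr A (word s i) (val s a) s)"
| Seq: "exec w V p s t s' \<Longrightarrow> exec w V q s' t' s'' \<Longrightarrow> exec w V (Seq p q) s (t + t') s''"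
| CondTrue: "holds b s \<Longrightarrow> exec w V p s t s' \<Longrightarrow> exec w V (Cond b p q) s (Suc t) s'"
| CondFalse: "\<not> holds b s \<Longrightarrow> exec w V q s t s' \<Longrightarrow> exec w V (Cond b p q) s (Suc t) s'"
| LoopEnd: "\<not> holds b s \<Longrightarrow> exec w V (Loop b p) s 1 s"
| LoopStep: "holds b s \<Longrightarrow> exec w V p s t s' \<Longrightarrow> exec w V (Loop b p) s' t' s'' \<Longrightarrow>
    exec w V (Loop b p) s (Suc (t + t')) s''"


section \<open>Matrix multiplication\<close>

text \<open>
  Programs whose only operations on values are the ring operations; in particular the control
  flow does not depend on values. These are the uniform arithmetic algorithms.
\<close>

fun test_arithmetic :: "test \<Rightarrow> bool" where
  "test_arithmetic (WLess a b) = True"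
| "test_arithmetic (VLess a b) = False"

fun arithmetic :: "prog \<Rightarrow> bool" where
  "arithmetic (VHalf d a) = False"
| "arithmetic (Seq p q) \<longleftrightarrow> arithmetic p \<and> arithmetic q"
| "arithmetic (Cond b p q) \<longleftrightarrow> test_arithmetic b \<and> arithmetic p \<and> arithmetic q"
| "arithmetic (Loop b p) \<longleftrightarrow> test_arithmetic b \<and> arithmetic p"
| "arithmetic p = True"

text \<open>
  \<open>n \<times> n\<close> matrices can be multiplied in \<open>O(n\<^sup>\<omega>)\<close> arithmetic operations. The dimension is
  passed in word 0, the factors in the value arrays 0 and 1, and the product is delivered in the
  value array 2, all in row-major order. The size of matrix entries is not restricted (\<open>V = UNIV\<close>),
  whereas words need only \<open>O(log n)\<close> bits. The remaining memory is not initialised, i.e. the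
  program has to work for every state \<open>s\<close> that contains the input.
\<close>

definition matrix_mult_exponent :: "real \<Rightarrow> bool" where
  "matrix_mult_exponent \<omega> \<longleftrightarrow>
    (\<exists>p c C. arithmetic p \<and>
      (\<forall>n (A :: nat \<Rightarrow> nat \<Rightarrow> real) (B :: nat \<Rightarrow> nat \<Rightarrow> real) w s.
        n \<ge> 1 \<longrightarrow>
        real w \<ge> c * log 2 (real n + 1) \<longrightarrow>
        word s 0 = n \<longrightarrow>
        (\<forall>i<n. \<forall>j<n. val_arr s 0 (i * n + j) = A i j \<and> val_arr s 1 (i * n + j) = B i j) \<longrightarrow>
        (\<exists>t s'. exec w UNIV p s t s' \<and> real t \<le> C * real n powr \<omega> \<and>
          (\<forall>i<n. \<forall>j<n. val_arr s' 2 (i * n + j) = (\<Sum>k<n. A i k * B k j)))))"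


section \<open>Vertex-weighted graphs and triangles\<close>

text \<open>Simple undirected graphs with vertex set \<open>{..<n}\<close>, given by their set of edges.\<close>

definition simple_graph :: "nat \<Rightarrow> nat set set \<Rightarrow> bool" where
  "simple_graph n E \<longleftrightarrow> (\<forall>e\<in>E. e \<subseteq> {..<n} \<and> card e = 2)"

definition triangle :: "nat set set \<Rightarrow> nat \<Rightarrow> nat \<Rightarrow> nat \<Rightarrow> bool" where
  "triangle E x y z \<longleftrightarrow> {x, y} \<in> E \<and> {y, z} \<in> E \<and> {x, z} \<in> E"

definition triangle_weight :: "(nat \<Rightarrow> real) \<Rightarrow> nat \<Rightarrow> nat \<Rightarrow> nat \<Rightarrow> real" where
  "triangle_weight wt x y z = wt x + wt y + wt z"

definition max_triangle :: "nat set set \<Rightarrow> (nat \<Rightarrow> real) \<Rightarrow> nat \<Rightarrow> nat \<Rightarrow> nat \<Rightarrow> bool" where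
  "max_triangle E wt x y z \<longleftrightarrow> triangle E x y z \<and>
    (\<forall>x' y' z'. triangle E x' y' z' \<longrightarrow> triangle_weight wt x' y' z' \<le> triangle_weight wt x y z)"

text \<open>The quantity \<open>W\<close>. By convention it is 0 if there is no triangle.\<close>

definition max_triangle_weight :: "nat set set \<Rightarrow> (nat \<Rightarrow> real) \<Rightarrow> real" where
  "max_triangle_weight E wt =
    (if \<exists>x y z. triangle E x y z
     then Max {triangle_weight wt x y z | x y z. triangle E x y z} else 0)"

text \<open>
  Bit lengths refer to the signed binary fixed-point representation: one bit for the sign, the
  bits of the integer part of \<open>\<bar>x\<bar>\<close>, and the bits after the binary point.
\<close>

definition finite_binary :: "real \<Rightarrow> bool" where
  "finite_binary x \<longleftrightarrow> (\<exists>k::nat. x * 2 ^ k \<in> \<int>)"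

definition num_bits :: "real \<Rightarrow> nat" where
  "num_bits x = 1 + (LEAST k. \<bar>x\<bar> < 2 ^ k) + (LEAST k. x * 2 ^ k \<in> \<int>)"

text \<open>The quantity \<open>B\<close>.\<close>

definition max_bits :: "nat \<Rightarrow> (nat \<Rightarrow> real) \<Rightarrow> nat" where
  "max_bits n wt = Max ((\<lambda>v. num_bits (wt v)) ` {..<n})"

definition values_of_length :: "nat \<Rightarrow> real set" where
  "values_of_length w = {x. finite_binary x \<and> num_bits x \<le> w}"


section \<open>Finding a maximum triangle\<close>

text \<open>
  Input: the number of vertices in word 0, the adjacency matrix in the word array 0, and the weights
  in the value array 0. The rest of the memory is not initialised.
\<close>

definition encodes_graph :: "state \<Rightarrow> nat \<Rightarrow> nat set set \<Rightarrow> (nat \<Rightarrow> real) \<Rightarrow> bool" where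
  "encodes_graph s n E wt \<longleftrightarrow>
    word s 0 = n \<and>
    (\<forall>i<n. \<forall>j<n. word_arr s 0 (i * n + j) = (if {i, j} \<in> E then 1 else 0)) \<and>
    (\<forall>i<n. val_arr s 0 i = wt i)"

text \<open>Output: word 0 tells whether there is a triangle; if so, words 1 to 3 form a maximum one.\<close>

definition reports_max_triangle :: "state \<Rightarrow> nat set set \<Rightarrow> (nat \<Rightarrow> real) \<Rightarrow> bool" where
  "reports_max_triangle s E wt \<longleftrightarrow>
    (if \<exists>x y z. triangle E x y z
     then word s 0 = 1 \<and> max_triangle E wt (word s 1) (word s 2) (word s 3)
     else word s 0 = 0)"

text \<open>
  \<open>max_triangle_in_time P f\<close>: for weight functions satisfying \<open>P n\<close>, where \<open>n \<ge> 1\<close> is the number of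
  vertices, a maximum triangle can be found in time \<open>O(f n E wt)\<close>, on machines whose words and
  values have \<open>O(B + log n)\<close> bits.
\<close>

definition max_triangle_in_time ::
  "(nat \<Rightarrow> (nat \<Rightarrow> real) \<Rightarrow> bool) \<Rightarrow> (nat \<Rightarrow> nat set set \<Rightarrow> (nat \<Rightarrow> real) \<Rightarrow> real) \<Rightarrow> bool" where
  "max_triangle_in_time P f \<longleftrightarrow>
    (\<exists>p c C. \<forall>n E wt w s.
      n \<ge> 1 \<longrightarrow> simple_graph n E \<longrightarrow> P n wt \<longrightarrow>
      real w \<ge> c * (real (max_bits n wt) + log 2 (real n + 1)) \<longrightarrow>
      encodes_graph s n E wt \<longrightarrow>
      (\<exists>t s'. exec w (values_of_length w) p s t s' \<and> real t \<le> C * f n E wt \<and>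
        reports_max_triangle s' E wt))"

definition integer_weights :: "nat \<Rightarrow> (nat \<Rightarrow> real) \<Rightarrow> bool" where
  "integer_weights n wt \<longleftrightarrow> (\<forall>v<n. wt v \<in> \<int>)"

definition finite_binary_weights :: "nat \<Rightarrow> (nat \<Rightarrow> real) \<Rightarrow> bool" where
  "finite_binary_weights n wt \<longleftrightarrow> (\<forall>v<n. finite_binary (wt v))"

text \<open>\<open>log W\<close>, made meaningful and bounded away from 0 also for \<open>W < 2\<close>.\<close>

definition log_weight :: "real \<Rightarrow> real" where
  "log_weight W = log 2 (max 2 \<bar>W\<bar>)"

end

theory Submission
  imports Defs "HOL-Number_Theory.Cong"
begin

text \<open>
  Sort the vertices by weight and cut the sorted sequence into \<open>m \<approx> \<surd>n\<close> blocks of length \<open>m\<close>. The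
  \<open>m\<^sup>3\<close> products of \<open>m \<times> m\<close> blocks of the adjacency matrix take \<open>O(m\<^sup>3 m\<^sup>\<omega>) = O(n\<^bsup>(\<omega> + 3) / 2\<^esup>)\<close>
  steps and reveal, for every pair of vertices, the last block that contains a common neighbour;
  a scan of that block finds the heaviest common neighbour. The scans take \<open>O(n\<^sup>2 m)\<close> steps,
  which is within the bound because \<open>\<omega> \<ge> 2\<close>. The weights are only compared and added in triples,
  so no factor depending on their size arises.

  The given multiplication program may produce arbitrarily long intermediate values. As it is
  arithmetic, it can be simulated by operations on words modulo \<open>m + 1\<close>, which exceeds every entry
  of a product of 0-1 matrices.
\<close>

section \<open>Reasoning about programs\<close>

text \<open>With blocks of length b the products cost (n/b)^3 b^\<omega> steps and the scans n^2 b.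
  The choice b = \<surd>n turns these into n^((\<omega> + 3) / 2) and n^(5/2). The second is
  admissible only for \<omega> \<ge> 2, a lower bound that has to be extracted from the definition
  of the exponent itself. A product tells whether a block contains a common neighbour, but not which
  one. Sorting makes this enough: no vertex of an earlier block outweighs one of a later block, so
  the last block with a common neighbour contains a heaviest one, and one scan per adjacent pair
  isolates it. The simulation works because the tests of an arithmetic program look at words only:
  the original run and its modular image take the same branches, so each instruction can be
  translated on its own at constant cost. The price is that every memory cell, initialised or not,
  must be readable as a residue.\<close>

definition runs ::
  "nat \<Rightarrow> real set \<Rightarrow> prog \<Rightarrow> state \<Rightarrow> nat \<Rightarrow> (state \<Rightarrow> bool) \<Rightarrow> bool" where
  "runs w V p s T Q \<longleftrightarrow> (\<exists>t s'. exec w V p s t s' \<and> t \<le> T \<and> Q s')"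

lemma set_word_simps [simp]:
  "word (set_word d x s) = (word s)(d := x)"
  "val (set_word d x s) = val s"
  "word_arr (set_word d x s) = word_arr s"
  "val_arr (set_word d x s) = val_arr s"
  by (simp_all add: set_word_def)

lemma set_val_simps [simp]:
  "val (set_val d x' s) = (val s)(d := x')"
  "word (set_val d x' s) = word s"
  "word_arr (set_val d x' s) = word_arr s"
  "val_arr (set_val d x' s) = val_arr s"
  by (simp_all add: set_val_def)

lemma set_word_arr_simps [simp]:
  "word_arr (set_word_arr A i x s) = (word_arr s)(A := (word_arr s A)(i := x))"
  "word (set_word_arr A i x s) = word s"
  "val (set_word_arr A i x s) = val s"
  "val_arr (set_word_arr A i x s) = val_arr s"
  by (simp_all add: set_word_arr_def)

lemma set_val_arr_simps [simp]:
  "val_arr (set_val_arr A i x' s) = (val_arr s)(A := (val_arr s A)(i := x'))"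
  "word (set_val_arr A i x' s) = word s"
  "val (set_val_arr A i x' s) = val s"
  "word_arr (set_val_arr A i x' s) = word_arr s"
  by (simp_all add: set_val_arr_def)

text \<open>On loops \<open>wp\<close> is false, so the value of \<open>steps\<close> does not matter there.\<close>

fun wp :: "nat \<Rightarrow> real set \<Rightarrow> prog \<Rightarrow> (state \<Rightarrow> bool) \<Rightarrow> state \<Rightarrow> bool" where
  "wp w V (WConst d k) Q s \<longleftrightarrow> k < 2 ^ w \<and> Q (set_word d k s)"
| "wp w V (WOp f d a b) Q s \<longleftrightarrow>
    word_op f (word s a) (word s b) < 2 ^ w \<and>
    Q (set_word d (word_op f (word s a) (word s b)) s)"
| "wp w V (WLoad d A i) Q s \<longleftrightarrow> Q (set_word d (word_arr s A (word s i)) s)"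
| "wp w V (WStore A i a) Q s \<longleftrightarrow> Q (set_word_arr A (word s i) (word s a) s)"
| "wp w V (VConst d z) Q s \<longleftrightarrow> of_int z \<in> V \<and> Q (set_val d (of_int z) s)"
| "wp w V (VOp g d a b) Q s \<longleftrightarrow>
    val_op g (val s a) (val s b) \<in> V \<and> Q (set_val d (val_op g (val s a) (val s b)) s)"
| "wp w V (VHalf d a) Q s \<longleftrightarrow> val s a / 2 \<in> V \<and> Q (set_val d (val s a / 2) s)"
| "wp w V (VLoad d A i) Q s \<longleftrightarrow> Q (set_val d (val_arr s A (word s i)) s)"
| "wp w V (VStore A i a) Q s \<longleftrightarrow> Q (set_val_arr A (word s i) (val s a) s)"
| "wp w V (Seq p q) Q s \<longleftrightarrow> wp w V p (wp w V q Q) s"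
| "wp w V (Cond b p q) Q s \<longleftrightarrow> (if holds b s then wp w V p Q s else wp w V q Q s)"
| "wp w V (Loop b p) Q s \<longleftrightarrow> False"

fun steps :: "prog \<Rightarrow> nat" where
  "steps (Seq p q) = steps p + steps q"
| "steps (Cond b p q) = Suc (max (steps p) (steps q))"
| "steps p = 1"

lemma runs_wp: "wp w V p Q s \<Longrightarrow> runs w V p s (steps p) Q"
proof (induction p arbitrary: Q s)
  case (Seq p q)
  then have "runs w V p s (steps p) (wp w V q Q)" by simp
  then obtain t s' where 1: "exec w V p s t s'" "t \<le> steps p" "wp w V q Q s'"
    by (auto simp: runs_def)
  from Seq.IH(2)[OF 1(3)] obtain t' s'' where "exec w V q s' t' s''" "t' \<le> steps q" "Q s''"
    by (auto simp: runs_def)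
  with 1 show ?case
    by (auto simp: runs_def intro!: exI[of _ "t + t'"] exI[of _ s''] intro: exec.Seq)
next
  case (Cond b p q)
  show ?case
  proof (cases "holds b s")
    case True
    with Cond have "runs w V p s (steps p) Q" by simp
    then obtain t s' where 1: "exec w V p s t s'" "t \<le> steps p" "Q s'"
      by (auto simp: runs_def)
    from True 1 show ?thesis
      by (auto simp: runs_def intro!: exI[of _ "Suc t"] exI[of _ s'] intro: exec.CondTrue)
  next
    case False
    with Cond have "runs w V q s (steps q) Q" by simp
    then obtain t s' where 1: "exec w V q s t s'" "t \<le> steps q" "Q s'"
      by (auto simp: runs_def)
    from False 1 show ?thesis
      by (auto simp: runs_def intro!: exI[of _ "Suc t"] exI[of _ s'] intro: exec.CondFalse)
  qed
qed (force simp: runs_def intro: exec.intros)+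

lemma runs_wp_le: "wp w V p Q s \<Longrightarrow> steps p \<le> T \<Longrightarrow> runs w V p s T Q"
  using runs_wp unfolding runs_def by (meson order_trans)

lemma runs_mono:
  "runs w V p s T Q \<Longrightarrow> T \<le> T' \<Longrightarrow> (\<And>s'. Q s' \<Longrightarrow> Q' s') \<Longrightarrow> runs w V p s T' Q'"
  unfolding runs_def by (meson order_trans)

lemma runs_Seq:
  "runs w V p s T (\<lambda>s'. runs w V q s' T' Q) \<Longrightarrow> runs w V (Seq p q) s (T + T') Q"
  unfolding runs_def by (meson add_mono exec.Seq)

lemma runs_Seq_le:
  assumes "runs w V p s T R" "\<And>s'. R s' \<Longrightarrow> runs w V q s' T' Q" "T + T' \<le> U"
  shows "runs w V (Seq p q) s U Q"
proof -
  have "runs w V p s T (\<lambda>s'. runs w V q s' T' Q)"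
    by (rule runs_mono[OF assms(1)]) (auto intro: assms(2))
  from runs_Seq[OF this] show ?thesis using assms(3) by (rule runs_mono) auto
qed

lemma runs_Cond_le:
  assumes "holds b s \<Longrightarrow> runs w V p s T Q" "\<not> holds b s \<Longrightarrow> runs w V q s T Q" "Suc T \<le> U"
  shows "runs w V (Cond b p q) s U Q"
  using assms unfolding runs_def
  by (cases "holds b s") (meson CondTrue CondFalse Suc_le_mono order_trans)+

text \<open>The variant \<open>f\<close> bounds the number of rounds. A round costs T steps and one
  test; the failing test at the end is the additional 1.\<close>

lemma runs_Loop:
  assumes "I s"
    and "\<And>s. I s \<Longrightarrow> holds b s \<Longrightarrow> runs w V p s T (\<lambda>s'. I s' \<and> f s' < f s)"
  shows "runs w V (Loop b p) s (f s * (T + 1) + 1) (\<lambda>s'. I s' \<and> \<not> holds b s')"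
  using assms(1)
proof (induction "f s" arbitrary: s rule: less_induct)
  case less
  show ?case
  proof (cases "holds b s")
    case False
    then show ?thesis using less.prems
      by (auto simp: runs_def intro!: exI[of _ 1] exI[of _ s] intro: exec.LoopEnd)
  next
    case True
    from assms(2)[OF less.prems True]
    obtain t s' where 1: "exec w V p s t s'" "t \<le> T" "I s'" "f s' < f s"
      by (auto simp: runs_def)
    from less.hyps[OF 1(4,3)] obtain t' s'' where
      2: "exec w V (Loop b p) s' t' s''" "t' \<le> f s' * (T + 1) + 1" "I s''" "\<not> holds b s''"
      by (auto simp: runs_def)
    \<comment> \<open>The strict decrease of the variant pays for the current round.\<close>
    have "Suc (f s') * (T + 1) \<le> f s * (T + 1)" using 1(4) by (intro mult_le_mono1) simp
    then have "Suc (t + t') \<le> f s * (T + 1) + 1" using 1(2) 2(2) by simp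
    with exec.LoopStep[OF True 1(1) 2(1)] 2(3,4) show ?thesis
      unfolding runs_def by blast
  qed
qed

section \<open>Frame conditions: memory that a program cannot change\<close>

fun words_written :: "prog \<Rightarrow> nat set" where
  "words_written (WConst d k) = {d}"
| "words_written (WOp f d a b) = {d}"
| "words_written (WLoad d A i) = {d}"
| "words_written (Seq p q) = words_written p \<union> words_written q"
| "words_written (Cond b p q) = words_written p \<union> words_written q"
| "words_written (Loop b p) = words_written p"
| "words_written _ = {}"

fun vals_written :: "prog \<Rightarrow> nat set" where
  "vals_written (VConst d k) = {d}"
| "vals_written (VOp f d a b) = {d}"
| "vals_written (VHalf d a) = {d}"
| "vals_written (VLoad d A i) = {d}"
| "vals_written (Seq p q) = vals_written p \<union> vals_written q"
| "vals_written (Cond b p q) = vals_written p \<union> vals_written q"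
| "vals_written (Loop b p) = vals_written p"
| "vals_written _ = {}"

fun word_arrs_written :: "prog \<Rightarrow> nat set" where
  "word_arrs_written (WStore A i a) = {A}"
| "word_arrs_written (Seq p q) = word_arrs_written p \<union> word_arrs_written q"
| "word_arrs_written (Cond b p q) = word_arrs_written p \<union> word_arrs_written q"
| "word_arrs_written (Loop b p) = word_arrs_written p"
| "word_arrs_written _ = {}"

fun val_arrs_written :: "prog \<Rightarrow> nat set" where
  "val_arrs_written (VStore A i a) = {A}"
| "val_arrs_written (Seq p q) = val_arrs_written p \<union> val_arrs_written q"
| "val_arrs_written (Cond b p q) = val_arrs_written p \<union> val_arrs_written q"
| "val_arrs_written (Loop b p) = val_arrs_written p"
| "val_arrs_written _ = {}"

definition agree :: "prog \<Rightarrow> state \<Rightarrow> state \<Rightarrow> bool" where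
  "agree p s s' \<longleftrightarrow>
    (\<forall>d. d \<notin> words_written p \<longrightarrow> word s' d = word s d) \<and>
    (\<forall>d. d \<notin> vals_written p \<longrightarrow> val s' d = val s d) \<and>
    (\<forall>A. A \<notin> word_arrs_written p \<longrightarrow> word_arr s' A = word_arr s A) \<and>
    (\<forall>A. A \<notin> val_arrs_written p \<longrightarrow> val_arr s' A = val_arr s A)"

lemma agreeD:
  assumes "agree p s s'"
  shows "d \<notin> words_written p \<Longrightarrow> word s' d = word s d"
    and "d \<notin> vals_written p \<Longrightarrow> val s' d = val s d"
    and "A \<notin> word_arrs_written p \<Longrightarrow> word_arr s' A = word_arr s A"
    and "A \<notin> val_arrs_written p \<Longrightarrow> val_arr s' A = val_arr s A"
  using assms by (auto simp: agree_def)

lemma agree_trans: "agree p s s' \<Longrightarrow> agree p s' s'' \<Longrightarrow> agree p s s''"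
  by (auto simp: agree_def)

lemma exec_agree: "exec w V p s t s' \<Longrightarrow> agree p s s'"
  by (induction rule: exec.induct) (auto simp: agree_def)

text \<open>Every execution respects the syntactic frame, so the frame can be added to any
  postcondition. Specifications therefore mention only the cells that change.\<close>

lemma runs_agree: "runs w V p s T Q \<Longrightarrow> runs w V p s T (\<lambda>s'. Q s' \<and> agree p s s')"
  unfolding runs_def using exec_agree by blast

text \<open>Word 4 always holds the constant 1 when a counting loop is entered.\<close>

definition For :: "nat \<Rightarrow> nat \<Rightarrow> prog \<Rightarrow> prog" where
  "For i n p = Seq (WConst i 0) (Loop (WLess i n) (Seq p (WOp WAdd i i 4)))"

lemma For_written [simp]:
  "words_written (For i n p) = insert i (words_written p)"
  "vals_written (For i n p) = vals_written p"
  "word_arrs_written (For i n p) = word_arrs_written p"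
  "val_arrs_written (For i n p) = val_arrs_written p"
  by (auto simp: For_def)

text \<open>A round costs the body, the increment and the test; the final 2 is the initialisation
  and the last test. The invariant must be insensitive to the counter, which is reset and
  incremented outside the body. The body may assume \<open>agree\<close> with the state before the
  loop, so that facts about that state need not be repeated in the invariant.\<close>

lemma runs_For:
  assumes N: "word s n = N" "N < 2 ^ w" and one: "word s 4 = 1"
    and i: "i \<notin> words_written p" "n \<notin> insert i (words_written p)"
      "4 \<notin> insert i (words_written p)"
    and I0: "I 0 s"
    and I_set: "\<And>k x s. I k s \<Longrightarrow> I k (set_word i x s)"
    and step: "\<And>k s'. \<lbrakk>k < N; I k s'; word s' i = k; agree (For i n p) s s'\<rbrakk> \<Longrightarrow>
      runs w V p s' T (I (Suc k))"
    and U: "N * (T + 2) + 2 \<le> U"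
  shows "runs w V (For i n p) s U (\<lambda>s'. I N s' \<and> agree (For i n p) s s')"
proof -
  let ?F = "For i n p"
  let ?J = "\<lambda>s'. word s' i \<le> N \<and> I (word s' i) s' \<and> agree ?F s s'"
  have 4: "i \<noteq> 4" using i by auto
  have body: "runs w V (Seq p (WOp WAdd i i 4)) s' (T + 1) (\<lambda>s''. ?J s'' \<and> N - word s'' i < N - word s' i)"
    if J: "?J s'" and h: "holds (WLess i n) s'" for s'
  proof -
    have [simp]: "word s' n = N" "word s' 4 = 1" using J i N one by (auto simp: agree_def)
    have lt: "word s' i < N" using h by simp
    have "runs w V p s' T (\<lambda>s''. I (Suc (word s' i)) s'' \<and> agree p s' s'')"
      using J lt by (intro runs_agree step) auto
    then show ?thesis
    proof (rule runs_Seq_le)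
      fix s'' assume 1: "I (Suc (word s' i)) s'' \<and> agree p s' s''"
      then have [simp]: "word s'' i = word s' i" "word s'' 4 = 1" using i by (auto simp: agree_def)
      have ag: "agree ?F s' s''" using 1 by (auto simp: agree_def)
      have ag2: "agree ?F s'' (set_word i x s'')" for x by (auto simp: agree_def)
      have ag3: "agree ?F s (set_word i x s'')" for x
        using J ag ag2 by (blast intro: agree_trans)
      show "runs w V (WOp WAdd i i 4) s'' 1 (\<lambda>s''. ?J s'' \<and> N - word s'' i < N - word s' i)"
        by (rule runs_wp_le) (use 1 lt N I_set ag3 in auto)
    qed simp
  qed
  have L: "runs w V (Loop (WLess i n) (Seq p (WOp WAdd i i 4))) s' ((N - word s' i) * (T + 1 + 1) + 1)
    (\<lambda>s'. ?J s' \<and> \<not> holds (WLess i n) s')" if "?J s'" for s'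
    by (rule runs_Loop[where I = ?J and f = "\<lambda>s. N - word s i", OF that body])
  have ag: "agree ?F s (set_word i 0 s)" by (auto simp: agree_def)
  show ?thesis unfolding For_def
  proof (rule runs_Seq_le)
    show "runs w V (WConst i 0) s 1 (\<lambda>s'. s' = set_word i 0 s)"
      by (rule runs_wp_le) auto
    fix s' assume s': "s' = set_word i 0 s"
    have "?J s'" using s' I0 I_set ag by auto
    from L[OF this] show "runs w V (Loop (WLess i n) (Seq p (WOp WAdd i i 4))) s'
        (N * (T + 2) + 1) (\<lambda>s''. I N s'' \<and> agree (Seq (WConst i 0) (Loop (WLess i n) (Seq p (WOp WAdd i i 4)))) s s'')"
    proof (rule runs_mono, goal_cases)
      case 1 then show ?case by (simp add: s')
    next
      case (2 s'')
      then have "word s'' n = N" using i N by (auto simp: agree_def)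
      with 2 have "word s'' i = N" by auto
      with 2 show ?case by (auto simp: For_def)
    qed
  qed (use U in simp)
qed

section \<open>Modular simulation of arithmetic programs\<close>

text \<open>Both kinds of data of the simulated program end up in words; the parity of the index
  keeps them apart.\<close>

abbreviation wreg :: "nat \<Rightarrow> nat" where "wreg i \<equiv> 100 + 2 * i"
abbreviation vreg :: "nat \<Rightarrow> nat" where "vreg i \<equiv> 101 + 2 * i"
abbreviation warr :: "nat \<Rightarrow> nat" where "warr A \<equiv> 10 + 2 * A"
abbreviation varr :: "nat \<Rightarrow> nat" where "varr A \<equiv> 11 + 2 * A"

text \<open>Adding word 5, which holds 0, is the way to copy a word; it is done only after the test
  has excluded words too long for the addition.\<close>

definition mod_clip :: "nat \<Rightarrow> nat \<Rightarrow> prog" where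
  "mod_clip d a = Cond (WLess a 8) (WOp WAdd d a 5) (WConst d 0)"

text \<open>In the absence of a remainder instruction, x mod P is computed as x - (x div P) * P,
  where no intermediate word exceeds x.\<close>

definition mod_reduce :: "nat \<Rightarrow> prog" where
  "mod_reduce d = Seq (WOp WDiv 10 9 8) (Seq (WOp WMul 10 10 8) (WOp WSub d 9 10))"

text \<open>Subtraction of words is truncated, so a difference of residues u and v is formed as u +
  (P - v).\<close>

fun mod_op :: "vop \<Rightarrow> prog" where
  "mod_op VAdd = WOp WAdd 9 9 10"
| "mod_op VSub = Seq (WOp WSub 10 8 10) (WOp WAdd 9 9 10)"
| "mod_op VMul = WOp WMul 9 9 10"

fun mod_test :: "test \<Rightarrow> test" where
  "mod_test (WLess a b) = WLess (wreg a) (wreg b)"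
| "mod_test (VLess a b) = VLess a b"

text \<open>
  Values become words modulo the content of word 8; words 9 and 10 are scratch space and word 5
  contains 0.
\<close>

fun mod_prog :: "prog \<Rightarrow> prog" where
  "mod_prog (WConst d k) = WConst (wreg d) k"
| "mod_prog (WOp f d a b) = WOp f (wreg d) (wreg a) (wreg b)"
| "mod_prog (WLoad d A i) = WLoad (wreg d) (warr A) (wreg i)"
| "mod_prog (WStore A i a) = WStore (warr A) (wreg i) (wreg a)"
| "mod_prog (VConst d k) = Seq (WConst 9 (nat \<bar>k\<bar>))
     (if 0 \<le> k then mod_reduce (vreg d) else Seq (mod_reduce 9) (WOp WSub (vreg d) 8 9))"
| "mod_prog (VOp f d a b) =
     Seq (mod_clip 9 (vreg a)) (Seq (mod_clip 10 (vreg b)) (Seq (mod_op f) (mod_reduce (vreg d))))"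
| "mod_prog (VHalf d a) = VHalf d a"
| "mod_prog (VLoad d A i) = WLoad (vreg d) (varr A) (wreg i)"
| "mod_prog (VStore A i a) = WStore (varr A) (wreg i) (vreg a)"
| "mod_prog (Seq p q) = Seq (mod_prog p) (mod_prog q)"
| "mod_prog (Cond b p q) = Cond (mod_test b) (mod_prog p) (mod_prog q)"
| "mod_prog (Loop b p) = Loop (mod_test b) (mod_prog p)"

text \<open>Only value constants count: word constants already fit, since the simulated execution
  loads them under the same word length.\<close>

fun max_const :: "prog \<Rightarrow> nat" where
  "max_const (VConst d k) = nat \<bar>k\<bar>"
| "max_const (Seq p q) = max (max_const p) (max_const q)"
| "max_const (Cond b p q) = max (max_const p) (max_const q)"
| "max_const (Loop b p) = max_const p"
| "max_const _ = 0"

text \<open>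
  Uninitialised cells may contain words beyond the word length, with which no arithmetic is
  possible; words outside the range of residues therefore stand for 0.
\<close>

definition clip :: "nat \<Rightarrow> nat \<Rightarrow> nat" where
  "clip P u = (if u < P then u else 0)"

text \<open>The value is an integer of unrestricted size of which only the residue is kept.
  Integrality is preserved because only ring operations and integer constants occur.\<close>

definition represents :: "nat \<Rightarrow> nat \<Rightarrow> real \<Rightarrow> bool" where
  "represents P u x \<longleftrightarrow> (\<exists>z. x = of_int z \<and> [int (clip P u) = z] (mod int P))"

text \<open>Words agree exactly, which makes tests and addresses coincide; only values are
  reduced.\<close>

definition simulates :: "nat \<Rightarrow> state \<Rightarrow> state \<Rightarrow> bool" where
  "simulates P c a \<longleftrightarrow> word c 5 = 0 \<and> word c 8 = P \<and>
    (\<forall>i. word c (wreg i) = word a i) \<and>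
    (\<forall>A. word_arr c (warr A) = word_arr a A) \<and>
    (\<forall>i. represents P (word c (vreg i)) (val a i)) \<and>
    (\<forall>A i. represents P (word_arr c (varr A) i) (val_arr a A i))"

lemma registers_disjoint [simp]:
  "vreg i \<noteq> wreg j" "wreg j \<noteq> vreg i" "varr i \<noteq> warr j" "warr j \<noteq> varr i"
  by presburger+

lemma represents_mod:
  "P > 0 \<Longrightarrow> [int u = z] (mod int P) \<Longrightarrow> represents P (u mod P) (of_int z)"
  by (auto simp: represents_def clip_def cong_def zmod_int)

lemma simulates_scratch [simp]:
  "simulates P (set_word 9 x c) a \<longleftrightarrow> simulates P c a"
  "simulates P (set_word 10 x c) a \<longleftrightarrow> simulates P c a"
  by (simp_all add: simulates_def)

lemma simulates_set_vreg:
  "simulates P c a \<Longrightarrow> represents P u x \<Longrightarrow>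
    simulates P (set_word (vreg d) u c) (set_val d x a)"
  by (auto simp: simulates_def)

lemma mod_clip_wp:
  "simulates P c a \<Longrightarrow> 0 < 2 ^ w \<Longrightarrow> P < 2 ^ w \<Longrightarrow>
    wp w V (mod_clip d r) Q c \<longleftrightarrow> Q (set_word d (clip P (word c r)) c)"
  by (auto simp: mod_clip_def clip_def simulates_def)

lemma mod_reduce_wp:
  assumes "word c 8 = P" "word c 9 < 2 ^ w"
  shows "wp w V (mod_reduce d) Q c \<longleftrightarrow>
    Q (set_word d (word c 9 mod P) (set_word 10 (word c 9 div P * P) c))"
proof -
  have "word c 9 div P * P \<le> word c 9" "word c 9 div P \<le> word c 9" "word c 9 mod P \<le> word c 9"
    by simp_all
  then have "word c 9 div P * P < 2 ^ w" "word c 9 div P < 2 ^ w" "word c 9 mod P < 2 ^ w"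
    using assms(2) by linarith+
  then show ?thesis using assms
    by (simp add: mod_reduce_def minus_div_mult_eq_mod set_word_def)
qed

text \<open>After clipping, both operands are below P, so sums stay below 2 * P and products below P
  * P; these are the two bounds on the word length.\<close>

lemma mod_op_correct:
  assumes P: "0 < P" "P * P < 2 ^ w" "2 * P < 2 ^ w" and sim: "simulates P c a"
  shows "wp w V (mod_prog (VOp f d x y))
    (\<lambda>c'. simulates P c' (set_val d (val_op f (val a x) (val a y)) a)) c"
proof -
  define u where "u = clip P (word c (vreg x))"
  define v where "v = clip P (word c (vreg y))"
  have uv: "u < P" "v < P" using P by (auto simp: u_def v_def clip_def)
  obtain zu zv where z: "val a x = of_int zu" "[int u = zu] (mod int P)"
      "val a y = of_int zv" "[int v = zv] (mod int P)"
    using sim unfolding simulates_def represents_def u_def v_def by metis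
  have "u + v < 2 ^ w" "u + (P - v) < 2 ^ w" "P - v < 2 ^ w" using uv P by linarith+
  moreover have "u * v < 2 ^ w"
    using mult_mono[of u P v P] uv P(2) by (simp add: order_le_less_trans)
  ultimately have less: "u + v < 2 ^ w" "u + (P - v) < 2 ^ w" "P - v < 2 ^ w" "u * v < 2 ^ w"
    by auto
  have "[int (u + v) = zu + zv] (mod int P)" "[int (u * v) = zu * zv] (mod int P)"
    using cong_add[OF z(2,4)] cong_mult[OF z(2,4)] by auto
  moreover have "[int (u + (P - v)) = zu - zv] (mod int P)"
    using cong_diff[OF z(2,4)] uv by (simp add: cong_def of_nat_diff add_diff_eq)
       (metis add_diff_eq diff_add_eq mod_add_self2 add.commute)
  ultimately have "represents P ((u + v) mod P) (val a x + val a y)"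
    "represents P ((u * v) mod P) (val a x * val a y)"
    "represents P ((u + (P - v)) mod P) (val a x - val a y)"
    using represents_mod[OF P(1)] z(1,3) by (metis of_int_add of_int_mult of_int_diff)+
  note rep = this
  have [simp]: "word c 8 = P" "word c 5 = 0" using sim by (auto simp: simulates_def)
  have "P < 2 ^ w" "0 < (2::nat) ^ w" using P by auto
  note clip = mod_clip_wp[OF _ this(2,1)]
  show ?thesis
    unfolding mod_prog.simps wp.simps
    apply (subst clip[OF sim])
    apply (subst clip[of _ a])
    subgoal using sim by simp
    using rep less sim
    by (cases f) (auto simp: mod_reduce_wp u_def v_def intro!: simulates_set_vreg)
qed

lemma mod_const_correct:
  assumes P: "0 < P" "P < 2 ^ w" "nat \<bar>k\<bar> < 2 ^ w" and sim: "simulates P c a"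
  shows "wp w V (mod_prog (VConst d k)) (\<lambda>c'. simulates P c' (set_val d (of_int k) a)) c"
proof -
  have [simp]: "word c 8 = P" "word c 5 = 0" using sim by (auto simp: simulates_def)
  define r where "r = nat \<bar>k\<bar> mod P"
  have r: "r < P" using P by (simp add: r_def)
  show ?thesis
  proof (cases "0 \<le> k")
    case True
    then have "represents P r (of_int k)"
      unfolding r_def using P by (intro represents_mod) auto
    with True P sim show ?thesis
      by (auto simp: mod_reduce_wp r_def intro!: simulates_set_vreg)
  next
    case False
    then have "[int r = - k] (mod int P)"
      by (simp add: r_def cong_def zmod_int)
    then have "[int P - int r = int P - (- k)] (mod int P)" by (intro cong_diff cong_refl)
    then have "[int (P - r) = k] (mod int P)" using r by (simp add: cong_def of_nat_diff)
    \<comment> \<open>If r = 0, the computed word is P itself, which is not a residue but is read as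
      0.\<close>
    then have "[int (clip P (P - r)) = k] (mod int P)" by (cases "r = 0") (auto simp: clip_def cong_def)
    then have "represents P (P - r) (of_int k)" by (auto simp: represents_def)
    moreover have "P - r < 2 ^ w" using P by linarith
    ultimately show ?thesis using False P sim
      by (auto simp: mod_reduce_wp r_def intro!: simulates_set_vreg)
  qed
qed

text \<open>The factor 9 comes from subtraction, the most expensive instruction: 2 + 2 steps for
  clipping the operands, 2 for the operation and 3 for the reduction.\<close>

lemma mod_prog_correct:
  assumes "exec w UNIV p a t a'" "arithmetic p" "max_const p < 2 ^ w"
    "0 < P" "P * P < 2 ^ w" "2 * P < 2 ^ w" "simulates P c a"
  shows "runs w V (mod_prog p) c (9 * t) (\<lambda>c'. simulates P c' a')"
  using assms
proof (induction arbitrary: c rule: exec.induct)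
  case (WConst k d s)
  show ?case by (rule runs_wp_le) (use WConst in \<open>auto simp: simulates_def\<close>)
next
  case (WOp x f s a b d)
  show ?case by (rule runs_wp_le) (use WOp in \<open>auto simp: simulates_def\<close>)
next
  case (WLoad d A i s)
  show ?case by (rule runs_wp_le) (use WLoad in \<open>auto simp: simulates_def\<close>)
next
  case (WStore A i a s)
  show ?case by (rule runs_wp_le) (use WStore in \<open>auto simp: simulates_def\<close>)
next
  case (VConst k d s)
  then have "P < 2 ^ w" by simp
  show ?case
    by (rule runs_wp_le[OF mod_const_correct])
       (use VConst \<open>P < 2 ^ w\<close> in \<open>auto simp: mod_reduce_def\<close>)
next
  case (VOp x f s a b d)
  show ?case unfolding VOp.hyps(1)
    using VOp.prems by (intro runs_wp_le[OF mod_op_correct])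
      (auto simp: mod_reduce_def mod_clip_def, cases f, auto)
next
  case (VHalf x s a d)
  then show ?case by simp
next
  case (VLoad d A i s)
  show ?case by (rule runs_wp_le) (use VLoad in \<open>auto simp: simulates_def\<close>)
next
  case (VStore A i a s)
  show ?case by (rule runs_wp_le) (use VStore in \<open>auto simp: simulates_def\<close>)
next
  case (Seq p s t s' q t' s'')
  show ?case unfolding mod_prog.simps
    by (rule runs_Seq_le[OF Seq.IH(1)]) (use Seq in auto)
next
  case (CondTrue b s p t s' q)
  then have "holds (mod_test b) c" by (cases b) (auto simp: simulates_def)
  then show ?case unfolding mod_prog.simps
    by (intro runs_Cond_le[of _ _ _ _ _ "9 * t"]) (use CondTrue in auto)
next
  case (CondFalse b s q t s' p)
  then have "\<not> holds (mod_test b) c" by (cases b) (auto simp: simulates_def)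
  then show ?case unfolding mod_prog.simps
    by (intro runs_Cond_le[of _ _ _ _ _ "9 * t"]) (use CondFalse in auto)
next
  case (LoopEnd b s p)
  then have "\<not> holds (mod_test b) c" by (cases b) (auto simp: simulates_def)
  with LoopEnd show ?case by (auto simp: runs_def intro!: exI[of _ 1] exec.LoopEnd)
next
  case (LoopStep b s p t s' t' s'')
  then have h: "holds (mod_test b) c" by (cases b) (auto simp: simulates_def)
  have "runs w V (mod_prog p) c (9 * t) (\<lambda>c'. simulates P c' s')" using LoopStep by simp
  then obtain u c' where 1: "exec w V (mod_prog p) c u c'" "u \<le> 9 * t" "simulates P c' s'"
    by (auto simp: runs_def)
  have "runs w V (mod_prog (Loop b p)) c' (9 * t') (\<lambda>c'. simulates P c' s'')"
    using LoopStep 1(3) by blast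
  then obtain u' c'' where 2: "exec w V (mod_prog (Loop b p)) c' u' c''" "u' \<le> 9 * t'"
      "simulates P c'' s''"
    by (auto simp: runs_def)
  have "Suc (u + u') \<le> 9 * Suc (t + t')" using 1(2) 2(2) by simp
  with exec.LoopStep[OF h 1(1) 2(1)[unfolded mod_prog.simps]] 2(3) show ?case
    unfolding runs_def by (intro exI[of _ "Suc (u + u')"] exI[of _ c'']) auto
qed

lemma mod_prog_written:
  assumes "arithmetic p"
  shows "words_written (mod_prog p) \<subseteq> {9, 10} \<union> {100..}" "vals_written (mod_prog p) = {}"
    "word_arrs_written (mod_prog p) \<subseteq> {10..}" "val_arrs_written (mod_prog p) = {}"
proof -
  have *: "x \<in> words_written (mod_op f) \<Longrightarrow> x = 9 \<or> x = 10" "vals_written (mod_op f) = {}"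
    "word_arrs_written (mod_op f) = {}" "val_arrs_written (mod_op f) = {}" for f x
    by (cases f; auto)+
  show "words_written (mod_prog p) \<subseteq> {9, 10} \<union> {100..}" "vals_written (mod_prog p) = {}"
    "word_arrs_written (mod_prog p) \<subseteq> {10..}" "val_arrs_written (mod_prog p) = {}"
    using assms
    by (induction p) (auto simp: mod_reduce_def mod_clip_def * dest: *(1))
qed

section \<open>The exponent of matrix multiplication\<close>

text \<open>The words and arrays named here are images of the interface of the original program:
  word 100 is \<open>wreg 0\<close>, and the arrays 11, 13 and 15 are \<open>varr 0\<close>,
  \<open>varr 1\<close> and \<open>varr 2\<close>.\<close>

lemma mod_matrix_mult:
  assumes "matrix_mult_exponent \<omega>"
  obtains p c Tm C where "arithmetic p" "\<And>m::nat. real (Tm m) \<le> C * real m powr \<omega>"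
    and "\<And>m A B w V s. \<lbrakk>m \<ge> 1; real w \<ge> c * log 2 (real m + 1); (m + 1) * (m + 1) < 2 ^ w;
      word s 5 = 0; word s 8 = m + 1; word s 100 = m;
      \<And>i j. i < m \<Longrightarrow> j < m \<Longrightarrow> word_arr s 11 (i * m + j) = A i j \<and> A i j \<le> 1;
      \<And>i j. i < m \<Longrightarrow> j < m \<Longrightarrow> word_arr s 13 (i * m + j) = B i j \<and> B i j \<le> 1\<rbrakk> \<Longrightarrow>
      runs w V (mod_prog p) s (Tm m) (\<lambda>s'. \<forall>i<m. \<forall>j<m.
        clip (m + 1) (word_arr s' 15 (i * m + j)) = (\<Sum>k<m. A i k * B k j :: nat))"
proof -
  from assms obtain p c C where p: "arithmetic p" and
    mult: "\<forall>n (A :: nat \<Rightarrow> nat \<Rightarrow> real) (B :: nat \<Rightarrow> nat \<Rightarrow> real) w s.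
        n \<ge> 1 \<longrightarrow> real w \<ge> c * log 2 (real n + 1) \<longrightarrow> word s 0 = n \<longrightarrow>
        (\<forall>i<n. \<forall>j<n. val_arr s 0 (i * n + j) = A i j \<and> val_arr s 1 (i * n + j) = B i j) \<longrightarrow>
        (\<exists>t s'. exec w UNIV p s t s' \<and> real t \<le> C * real n powr \<omega> \<and>
          (\<forall>i<n. \<forall>j<n. val_arr s' 2 (i * n + j) = (\<Sum>k<n. A i k * B k j)))"
    unfolding matrix_mult_exponent_def by blast
  note mult = mult[THEN spec, THEN spec, THEN spec, THEN spec, THEN spec,
      THEN mp, THEN mp, THEN mp, THEN mp]
  define Tm where "Tm m = 9 * nat \<lfloor>C * real m powr \<omega>\<rfloor>" for m
  \<comment> \<open>The logarithm is at least 1 since m \<ge> 1, so a factor exceeding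
    \<open>max_const p\<close> makes the constants of \<open>p\<close> fit a word as well.\<close>
  define c' where "c' = max c (real (Suc (max_const p)))"
  show ?thesis
  proof (rule that[of p Tm "9 * \<bar>C\<bar>" c'])
    show "real (Tm m) \<le> 9 * \<bar>C\<bar> * real m powr \<omega>" for m
    proof -
      have "real (nat \<lfloor>C * real m powr \<omega>\<rfloor>) \<le> \<bar>C * real m powr \<omega>\<bar>" by linarith
      then show ?thesis by (simp add: Tm_def abs_mult)
    qed
    fix m w :: nat and A B :: "nat \<Rightarrow> nat \<Rightarrow> nat" and V and s :: state
    assume m: "m \<ge> 1" and w: "real w \<ge> c' * log 2 (real m + 1)" "(m + 1) * (m + 1) < 2 ^ w"
      and s: "word s 5 = 0" "word s 8 = m + 1" "word s 100 = m"
      and A: "\<And>i j. i < m \<Longrightarrow> j < m \<Longrightarrow> word_arr s 11 (i * m + j) = A i j \<and> A i j \<le> 1"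
      and B: "\<And>i j. i < m \<Longrightarrow> j < m \<Longrightarrow> word_arr s 13 (i * m + j) = B i j \<and> B i j \<le> 1"
    have log1: "log 2 (real m + 1) \<ge> 1" using m by (simp add: le_log_iff)
    have "c * log 2 (real m + 1) \<le> c' * log 2 (real m + 1)"
      using log1 by (intro mult_right_mono) (auto simp: c'_def)
    then have wc: "real w \<ge> c * log 2 (real m + 1)" using w(1) by (rule order_trans)
    have "real (Suc (max_const p)) * 1 \<le> c' * log 2 (real m + 1)"
      using log1 by (intro mult_mono) (auto simp: c'_def)
    from order_trans[OF this w(1)] have "real (Suc (max_const p)) \<le> real w" by simp
    then have "Suc (max_const p) \<le> w" unfolding of_nat_le_iff .
    then have const: "max_const p < 2 ^ w"
      by (meson Suc_le_lessD less_exp less_trans)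
    \<comment> \<open>The original program works from every state that contains the input. It is
      started in the state that the given memory represents, with arbitrary garbage read as clipped
      residues.\<close>
    define a where "a = \<lparr>word = \<lambda>i. word s (wreg i), val = \<lambda>i. real (clip (m + 1) (word s (vreg i))),
      word_arr = \<lambda>A. word_arr s (warr A), val_arr = \<lambda>A i. real (clip (m + 1) (word_arr s (varr A) i))\<rparr>"
    have rep: "represents P u (real (clip P u))" for P u
      unfolding represents_def by (intro exI[of _ "int (clip P u)"]) simp
    have sim: "simulates (m + 1) s a"
      using s by (simp add: simulates_def a_def rep)
    have "\<forall>i<m. \<forall>j<m. val_arr a 0 (i * m + j) = real (A i j) \<and> val_arr a 1 (i * m + j) = real (B i j)"
    proof (intro allI impI)
      fix i j assume ij: "i < m" "j < m"
      have "A i j < m + 1" "B i j < m + 1" using A[OF ij] B[OF ij] m by simp_all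
      then show "val_arr a 0 (i * m + j) = real (A i j) \<and> val_arr a 1 (i * m + j) = real (B i j)"
        using A[OF ij] B[OF ij] by (simp add: a_def clip_def)
    qed
    moreover have "word a 0 = m" using s by (simp add: a_def)
    ultimately obtain t a' where
      a': "exec w UNIV p a t a'" "real t \<le> C * real m powr \<omega>" and
      prod: "\<forall>i<m. \<forall>j<m. val_arr a' 2 (i * m + j) = (\<Sum>k<m. real (A i k) * real (B k j))"
      using mult[OF m wc, of a "\<lambda>i j. real (A i j)" "\<lambda>i j. real (B i j)"] by blast
    have t9: "9 * t \<le> Tm m" using a'(2) by (simp add: Tm_def le_nat_floor)
    have "2 * (m + 1) \<le> (m + 1) * (m + 1)" using m by (intro mult_le_mono1) simp
    then have "2 * (m + 1) < 2 ^ w" using w(2) by linarith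
    then have r9: "runs w V (mod_prog p) s (9 * t) (\<lambda>c'. simulates (m + 1) c' a')"
      using a'(1) p const w(2) sim by (intro mod_prog_correct[where P = "m + 1"]) auto
    show "runs w V (mod_prog p) s (Tm m) (\<lambda>s'. \<forall>i<m. \<forall>j<m.
        clip (m + 1) (word_arr s' 15 (i * m + j)) = (\<Sum>k<m. A i k * B k j))"
    proof (rule runs_mono[OF r9 t9], intro allI impI)
      fix s' i j assume sim': "simulates (m + 1) s' a'" and ij: "i < m" "j < m"
      let ?x = "\<Sum>k<m. A i k * B k j"
      let ?u = "clip (m + 1) (word_arr s' 15 (i * m + j))"
      have "represents (m + 1) (word_arr s' (varr 2) (i * m + j)) (val_arr a' 2 (i * m + j))"
        using sim' by (simp only: simulates_def)
      then obtain z where z: "val_arr a' 2 (i * m + j) = of_int z" "[int ?u = z] (mod int (m + 1))"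
        by (auto simp: represents_def)
      have "real ?x = of_int z" using prod ij z(1) by simp
      then have "z = int ?x" by (metis of_int_eq_iff of_int_of_nat_eq)
      with z(2) have "[int ?u = int ?x] (mod int (m + 1))" by simp
      then have "?u mod (m + 1) = ?x mod (m + 1)" unfolding cong_int_iff by (simp only: cong_def)
      moreover have "?u < m + 1" by (simp add: clip_def)
      \<comment> \<open>With entries at most 1, each entry of the product is at most m, hence
        determined by its residue modulo m + 1.\<close>
      moreover have "?x \<le> (\<Sum>k<m. 1)"
        using A B ij by (intro sum_mono) (metis lessThan_iff mult_le_mono nat_mult_1)
      then have "?x < m + 1" by simp
      ultimately show "?u = ?x" by simp
    qed
  qed (use p in auto)
qed

text \<open>A multiplication program may have to change all \<open>n\<^sup>2\<close> cells of the output array.\<close>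

lemma exec_val_arr_changes:
  "exec w V p s t s' \<Longrightarrow>
    finite {i. val_arr s' A i \<noteq> val_arr s A i} \<and> card {i. val_arr s' A i \<noteq> val_arr s A i} \<le> t"
proof (induction rule: exec.induct)
  case (VStore A' i a s)
  have "{j. val_arr (set_val_arr A' (word s i) (val s a) s) A j \<noteq> val_arr s A j} \<subseteq> {word s i}"
    by (auto split: if_splits)
  from finite_subset[OF this] card_mono[OF _ this] show ?case by simp
next
  case (Seq p s t s' q t' s'')
  let ?X = "{i. val_arr s' A i \<noteq> val_arr s A i}" and ?Y = "{i. val_arr s'' A i \<noteq> val_arr s' A i}"
  have sub: "{i. val_arr s'' A i \<noteq> val_arr s A i} \<subseteq> ?X \<union> ?Y" by auto
  with Seq.IH have "card {i. val_arr s'' A i \<noteq> val_arr s A i} \<le> card (?X \<union> ?Y)"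
    by (intro card_mono) auto
  also have "\<dots> \<le> t + t'" using card_Un_le[of ?X ?Y] Seq.IH by linarith
  finally show ?case using finite_subset[OF sub] Seq.IH by simp
next
  case (LoopStep b s p t s' t' s'')
  let ?X = "{i. val_arr s' A i \<noteq> val_arr s A i}" and ?Y = "{i. val_arr s'' A i \<noteq> val_arr s' A i}"
  have sub: "{i. val_arr s'' A i \<noteq> val_arr s A i} \<subseteq> ?X \<union> ?Y" by auto
  with LoopStep.IH have "card {i. val_arr s'' A i \<noteq> val_arr s A i} \<le> card (?X \<union> ?Y)"
    by (intro card_mono) auto
  also have "\<dots> \<le> t + t'" using card_Un_le[of ?X ?Y] LoopStep.IH by linarith
  finally show ?case using finite_subset[OF sub] LoopStep.IH by simp
qed auto

text \<open>For all-ones factors every entry of the product is n \<noteq> 0. If the output array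
  starts with zeros, all n^2 cells must change, at most one per step. So n^2 \<le> C n^\<omega> for
  all n \<ge> 1, which is impossible for \<omega> < 2.\<close>

lemma matrix_mult_exponent_ge_2:
  assumes "matrix_mult_exponent \<omega>"
  shows "\<omega> \<ge> 2"
proof (rule ccontr)
  assume "\<not> \<omega> \<ge> 2"
  then have pos: "2 - \<omega> > 0" by simp
  from assms obtain p c C where
    mult: "\<forall>n (A :: nat \<Rightarrow> nat \<Rightarrow> real) (B :: nat \<Rightarrow> nat \<Rightarrow> real) w s.
        n \<ge> 1 \<longrightarrow> real w \<ge> c * log 2 (real n + 1) \<longrightarrow> word s 0 = n \<longrightarrow>
        (\<forall>i<n. \<forall>j<n. val_arr s 0 (i * n + j) = A i j \<and> val_arr s 1 (i * n + j) = B i j) \<longrightarrow>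
        (\<exists>t s'. exec w UNIV p s t s' \<and> real t \<le> C * real n powr \<omega> \<and>
          (\<forall>i<n. \<forall>j<n. val_arr s' 2 (i * n + j) = (\<Sum>k<n. A i k * B k j)))"
    unfolding matrix_mult_exponent_def by blast
  note mult = mult[THEN spec, THEN spec, THEN spec, THEN spec, THEN spec,
      THEN mp, THEN mp, THEN mp, THEN mp]
  have bound: "real n powr (2 - \<omega>) \<le> C" if n: "n \<ge> 1" for n
  proof -
    define s where "s = \<lparr>word = \<lambda>_. n, val = \<lambda>_. 0, word_arr = \<lambda>_ _. 0,
      val_arr = \<lambda>A _. if A = 2 then 0 else 1\<rparr>"
    obtain w :: nat where w: "real w \<ge> c * log 2 (real n + 1)" using real_arch_simple by blast
    have "\<exists>t s'. exec w UNIV p s t s' \<and> real t \<le> C * real n powr \<omega> \<and>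
          (\<forall>i<n. \<forall>j<n. val_arr s' 2 (i * n + j) = (\<Sum>k<n. (1::real) * 1))"
      by (rule mult[OF n w, of s "\<lambda>_ _. 1" "\<lambda>_ _. 1"]) (auto simp: s_def)
    then obtain t s' where 1: "exec w UNIV p s t s'" "real t \<le> C * real n powr \<omega>"
      "\<And>i j. i < n \<Longrightarrow> j < n \<Longrightarrow> val_arr s' 2 (i * n + j) = n"
      by auto
    have "{..<n * n} \<subseteq> {i. val_arr s' 2 i \<noteq> val_arr s 2 i}"
    proof
      fix e assume "e \<in> {..<n * n}"
      then have "e div n < n" "e mod n < n"
        using n by (auto simp: less_mult_imp_div_less)
      from 1(3)[OF this] n show "e \<in> {i. val_arr s' 2 i \<noteq> val_arr s 2 i}"
        by (simp add: s_def)
    qed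
    from card_mono[OF _ this] exec_val_arr_changes[OF 1(1), of 2] have "n * n \<le> t" by auto
    then have "real n powr 2 \<le> C * real n powr \<omega>"
      using 1(2) n by (simp add: power2_eq_square powr_numeral flip: of_nat_mult)
    then show ?thesis using n by (simp add: powr_diff field_simps)
  qed
  have "\<bar>C\<bar> + 1 > 0" by simp
  \<comment> \<open>Chosen such that x^(2 - \<omega>) = \<bar>C\<bar> + 1, which exceeds C.\<close>
  define x where "x = (\<bar>C\<bar> + 1) powr (1 / (2 - \<omega>))"
  obtain n :: nat where n: "real n \<ge> max 1 x" using real_arch_simple by blast
  have "\<bar>C\<bar> + 1 = x powr (2 - \<omega>)" using pos by (simp add: x_def powr_powr)
  also have "\<dots> \<le> real n powr (2 - \<omega>)" using n pos by (intro powr_mono2) (auto simp: x_def)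
  also have "\<dots> \<le> C" using n by (intro bound) simp
  finally show False by simp
qed

section \<open>The program\<close>

text \<open>
  Words 6, 7, 8 and 11 hold \<open>m\<close>, \<open>M = m * m\<close>, \<open>m + 1\<close> and \<open>M * M\<close>; word 22 tells whether a triangle
  has been found, in which case words 1 to 3 and value 3 hold the best one and its weight. Word
  array 1 lists the vertices by increasing weight, word array 2 is the \<open>M \<times> M\<close> adjacency matrix in
  this order, padded with zeros, and word array 3 holds, for the \<open>M\<close> pairs of the current pair of
  blocks, the successor of the last block with a common neighbour, or 0 if there is none. The
  simulated multiplication uses the words from 100 and the arrays from 10 on; its factors are the
  arrays 11 and 13, and its product is the array 15.
\<close>

abbreviation skip :: prog where "skip \<equiv> WConst 31 0"

text \<open>Instead of extracting a square root, m is counted up from 0 until its square reaches n;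
  this takes O(m) steps.\<close>

definition init_prog :: prog where
  "init_prog =
    Seq (Seq (WConst 4 1) (Seq (WConst 5 0) (Seq (WConst 6 0) (WConst 7 0))))
    (Seq (Loop (WLess 7 0) (Seq (WOp WAdd 6 6 4) (WOp WMul 7 6 6)))
    (Seq (WOp WAdd 8 6 4) (WOp WMul 11 7 7)))"

definition compare_prog :: prog where
  "compare_prog =
    Seq (VLoad 0 0 13) (Seq (VLoad 1 0 12)
    (Cond (VLess 0 1) (WOp WAdd 18 18 4)
    (Cond (VLess 1 0) skip
    (Cond (WLess 13 12) (WOp WAdd 18 18 4) skip))))"

text \<open>Sorting by ranks: each vertex is stored at the number of its predecessors. Quadratic
  time is affordable here.\<close>

definition sort_prog :: prog where
  "sort_prog = For 12 0 (Seq (WConst 18 0) (Seq (For 13 0 compare_prog) (WStore 1 18 12)))"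

definition matrix_prog :: prog where
  "matrix_prog = For 12 11
    (Seq (WOp WDiv 18 12 7) (Seq (WOp WMul 19 18 7) (Seq (WOp WSub 19 12 19) (Seq (WConst 23 0)
    (Seq (Cond (WLess 18 0) (Cond (WLess 19 0)
       (Seq (WLoad 24 1 18) (Seq (WLoad 25 1 19) (Seq (WOp WMul 24 24 0)
       (Seq (WOp WAdd 24 24 25) (WLoad 23 0 24))))) skip) skip)
    (WStore 2 12 23))))))"

text \<open>The parameters \<open>r\<close> and \<open>c\<close> are the indices of the words that
  hold the block coordinates, not the coordinates themselves.\<close>

definition copy_block :: "nat \<Rightarrow> nat \<Rightarrow> nat \<Rightarrow> prog" where
  "copy_block r c A = For 15 7
    (Seq (WOp WDiv 18 15 6) (Seq (WOp WMul 19 18 6) (Seq (WOp WSub 19 15 19)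
    (Seq (WOp WMul 23 r 6) (Seq (WOp WAdd 23 23 18) (Seq (WOp WMul 23 23 7)
    (Seq (WOp WMul 24 c 6) (Seq (WOp WAdd 24 24 19) (Seq (WOp WAdd 23 23 24)
    (Seq (WLoad 25 2 23) (WStore A 15 25)))))))))))"

definition clear_prog :: prog where
  "clear_prog = For 15 7 (WStore 3 15 5)"

text \<open>The test against word 8 implements \<open>clip\<close>: an output cell outside the range
  of residues stands for 0. Blocks are visited in increasing order, so overwriting keeps the last
  one.\<close>

definition update_prog :: prog where
  "update_prog = For 15 7
    (Seq (WLoad 23 15 15)
    (Cond (WLess 5 23) (Cond (WLess 23 8) (Seq (WOp WAdd 24 14 4) (WStore 3 15 24)) skip) skip))"

text \<open>Word 100 is the dimension of the simulated program, which may overwrite it; hence it is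
  set anew in every round.\<close>

definition witness_block_prog :: "prog \<Rightarrow> prog" where
  "witness_block_prog p = For 14 6
    (Seq (copy_block 20 14 11) (Seq (copy_block 14 21 13)
    (Seq (WOp WAdd 100 6 5) (Seq (mod_prog p) update_prog))))"

text \<open>The scan goes upwards and overwrites word 27, so the largest position survives, which is
  a heaviest one by the sorting.\<close>

definition scan_block_prog :: prog where
  "scan_block_prog = For 17 6
    (Seq (WOp WAdd 28 23 17)
    (Seq (WOp WMul 29 24 7) (Seq (WOp WAdd 29 29 28) (Seq (WLoad 29 2 29)
    (Seq (WOp WMul 30 25 7) (Seq (WOp WAdd 30 30 28) (Seq (WLoad 30 2 30)
    (Cond (WLess 5 29) (Cond (WLess 5 30) (WOp WAdd 27 28 5) skip) skip))))))))"

text \<open>Word 22 guards the comparison because value 3 is uninitialised until a triangle has been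
  found. The new weight is added up a second time, as no single instruction copies a value
  scalar.\<close>

definition candidate_prog :: prog where
  "candidate_prog =
    Seq (WLoad 28 1 24) (Seq (WLoad 29 1 25) (Seq (WLoad 30 1 27)
    (Seq (VLoad 0 0 28) (Seq (VLoad 1 0 29) (Seq (VLoad 2 0 30)
    (Seq (VOp VAdd 0 0 1) (Seq (VOp VAdd 4 0 2)
    (Seq (Cond (WLess 5 22) (Cond (VLess 3 4) (WConst 26 1) (WConst 26 0)) (WConst 26 1))
    (Cond (WLess 5 26)
      (Seq (WOp WAdd 1 28 5) (Seq (WOp WAdd 2 29 5) (Seq (WOp WAdd 3 30 5)
      (Seq (VOp VAdd 3 0 2) (WConst 22 1))))) skip)))))))))"

definition pair_prog :: prog where
  "pair_prog =
    Seq (WLoad 23 3 15) (Cond (WLess 5 23)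
      (Seq
        (Seq (WOp WDiv 18 15 6) (Seq (WOp WMul 19 18 6) (Seq (WOp WSub 19 15 19)
        (Seq (WOp WMul 24 20 6) (Seq (WOp WAdd 24 24 18)
        (Seq (WOp WMul 25 21 6) (Seq (WOp WAdd 25 25 19)
        (Seq (WOp WMul 26 24 7) (Seq (WOp WAdd 26 26 25) (WLoad 26 2 26))))))))))
        (Cond (WLess 5 26)
          (Seq (Seq (WOp WSub 23 23 4) (Seq (WOp WMul 23 23 6) (WConst 27 0)))
          (Seq scan_block_prog candidate_prog)) skip)) skip)"

definition search_prog :: "prog \<Rightarrow> prog" where
  "search_prog p = For 12 7
    (Seq (Seq (WOp WDiv 20 12 6) (Seq (WOp WMul 21 20 6) (WOp WSub 21 12 21)))
    (Seq clear_prog (Seq (witness_block_prog p) (For 15 7 pair_prog))))"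

definition max_triangle_prog :: "prog \<Rightarrow> prog" where
  "max_triangle_prog p =
    Seq init_prog (Seq sort_prog (Seq matrix_prog
    (Seq (WConst 22 0) (Seq (search_prog p) (WOp WAdd 0 22 5)))))"

lemma copy_block_written [simp]:
  "words_written (copy_block r c A) = {15, 18, 19, 23, 24, 25}"
  "vals_written (copy_block r c A) = {}"
  "word_arrs_written (copy_block r c A) = {A}"
  "val_arrs_written (copy_block r c A) = {}"
  by (auto simp: copy_block_def)

lemma update_prog_written [simp]:
  "words_written update_prog = {15, 23, 24, 31}"
  "vals_written update_prog = {}"
  "word_arrs_written update_prog = {3}"
  "val_arrs_written update_prog = {}"
  by (auto simp: update_prog_def)

lemma scan_block_prog_written [simp]:
  "words_written scan_block_prog = {17, 27, 28, 29, 30, 31}"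
  "vals_written scan_block_prog = {}"
  "word_arrs_written scan_block_prog = {}"
  "val_arrs_written scan_block_prog = {}"
  by (auto simp: scan_block_prog_def)

lemma candidate_prog_written [simp]:
  "words_written candidate_prog = {1, 2, 3, 22, 26, 28, 29, 30, 31}"
  "vals_written candidate_prog = {0, 1, 2, 3, 4}"
  "word_arrs_written candidate_prog = {}"
  "val_arrs_written candidate_prog = {}"
  by (auto simp: candidate_prog_def)

lemma pair_prog_written [simp]:
  "words_written pair_prog = {1, 2, 3, 17, 18, 19, 22, 23, 24, 25, 26, 27, 28, 29, 30, 31}"
  "vals_written pair_prog = {0, 1, 2, 3, 4}"
  "word_arrs_written pair_prog = {}"
  "val_arrs_written pair_prog = {}"
  by (auto simp: pair_prog_def)

lemma clear_prog_written [simp]: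
  "words_written clear_prog = {15}"
  "vals_written clear_prog = {}"
  "word_arrs_written clear_prog = {3}"
  "val_arrs_written clear_prog = {}"
  by (auto simp: clear_prog_def)

lemma mod_prog_not_written:
  assumes "arithmetic p"
  shows "d < 100 \<Longrightarrow> d \<noteq> 9 \<Longrightarrow> d \<noteq> 10 \<Longrightarrow> d \<notin> words_written (mod_prog p)"
    and "A < 10 \<Longrightarrow> A \<notin> word_arrs_written (mod_prog p)"
  using mod_prog_written[OF assms] by fastforce+

section \<open>Sorting the vertices by weight\<close>

text \<open>Breaking ties by the number of the vertex yields a strict linear order, so that ranks
  are distinct and no two vertices compete for a position.\<close>

definition before :: "(nat \<Rightarrow> real) \<Rightarrow> nat \<Rightarrow> nat \<Rightarrow> bool" where
  "before wt u v \<longleftrightarrow> wt u < wt v \<or> wt u = wt v \<and> u < v"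

definition rank :: "nat \<Rightarrow> (nat \<Rightarrow> real) \<Rightarrow> nat \<Rightarrow> nat" where
  "rank n wt v = card {u. u < n \<and> before wt u v}"

lemma rank_less: "v < n \<Longrightarrow> rank n wt v < n"
proof -
  assume "v < n"
  then have "{u. u < n \<and> before wt u v} \<subset> {..<n}" by (auto simp: before_def)
  from psubset_card_mono[OF _ this] show ?thesis by (simp add: rank_def)
qed

lemma rank_mono: "u < n \<Longrightarrow> before wt u v \<Longrightarrow> rank n wt u < rank n wt v"
  unfolding rank_def by (rule psubset_card_mono) (auto simp: before_def)

lemma before_linear: "u \<noteq> v \<Longrightarrow> before wt u v \<or> before wt v u"
  by (auto simp: before_def)

lemma rank_bij: "bij_betw (rank n wt) {..<n} {..<n}"
proof -
  have "inj_on (rank n wt) {..<n}"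
    by (rule inj_onI) (metis before_linear lessThan_iff less_irrefl rank_mono)
  moreover have "rank n wt ` {..<n} \<subseteq> {..<n}" using rank_less by auto
  ultimately show ?thesis by (simp add: bij_betw_def endo_inj_surj)
qed

definition vertex_at :: "nat \<Rightarrow> (nat \<Rightarrow> real) \<Rightarrow> nat \<Rightarrow> nat" where
  "vertex_at n wt = inv_into {..<n} (rank n wt)"

lemma vertex_at_rank: "v < n \<Longrightarrow> vertex_at n wt (rank n wt v) = v"
  unfolding vertex_at_def using rank_bij by (intro inv_into_f_f) (auto simp: bij_betw_def)

lemma vertex_at: "i < n \<Longrightarrow> vertex_at n wt i < n \<and> rank n wt (vertex_at n wt i) = i"
  using bij_betw_inv_into[OF rank_bij, of n wt] bij_betw_inv_into_right[OF rank_bij, of i n wt]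
  by (auto simp: vertex_at_def bij_betw_def)

lemma vertex_at_sorted:
  assumes "i \<le> j" "j < n"
  shows "wt (vertex_at n wt i) \<le> wt (vertex_at n wt j)"
proof (rule ccontr)
  assume "\<not> ?thesis"
  then have "before wt (vertex_at n wt j) (vertex_at n wt i)" by (simp add: before_def)
  with rank_mono[OF _ this, of n] vertex_at[of i n wt] vertex_at[of j n wt] assms show False
    by auto
qed

lemma compare_step:
  "card {u. u < Suc k \<and> before wt u v} =
    card {u. u < k \<and> before wt u v} + (if before wt k v then 1 else 0)"
proof -
  have "{u. u < Suc k \<and> before wt u v} =
    (if before wt k v then insert k {u. u < k \<and> before wt u v} else {u. u < k \<and> before wt u v})"
    by (auto simp: less_Suc_eq)
  then show ?thesis by simp
qed

lemma sort_prog_correct: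
  assumes s: "word s 0 = n" "word s 4 = 1" "n < 2 ^ w" "\<And>v. v < n \<Longrightarrow> val_arr s 0 v = wt v"
  shows "runs w V sort_prog s (n * (n * 8 + 6) + 2)
    (\<lambda>s'. (\<forall>i<n. word_arr s' 1 i = vertex_at n wt i) \<and> agree sort_prog s s')"
proof -
  let ?I = "\<lambda>k s'. \<forall>v<k. word_arr s' 1 (rank n wt v) = v"
  have "runs w V sort_prog s (n * (n * 8 + 6) + 2) (\<lambda>s'. ?I n s' \<and> agree sort_prog s s')"
    unfolding sort_prog_def
  proof (rule runs_For[where T = "n * 8 + 4" and N = n and I = ?I])
    fix v s1 assume v: "v < n" "?I v s1" "word s1 12 = v"
      and ag: "agree (For 12 0 (Seq (WConst 18 0) (Seq (For 13 0 compare_prog) (WStore 1 18 12)))) s s1"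
    note agreeD[OF ag, simp]
    have [simp]: "0 < (2::nat) ^ w" by simp
    show "runs w V (Seq (WConst 18 0) (Seq (For 13 0 compare_prog) (WStore 1 18 12))) s1 (n * 8 + 4)
      (?I (Suc v))"
    proof (rule runs_Seq_le)
      show "runs w V (WConst 18 0) s1 1 (\<lambda>s2. s2 = set_word 18 0 s1)"
        by (rule runs_wp_le) auto
      fix s2 assume s2: "s2 = set_word 18 0 s1"
      show "runs w V (Seq (For 13 0 compare_prog) (WStore 1 18 12)) s2 (n * 8 + 3) (?I (Suc v))"
      proof (rule runs_Seq_le)
        show "runs w V (For 13 0 compare_prog) s2 (n * (6 + 2) + 2)
          (\<lambda>s3. word s3 18 = card {u. u < n \<and> before wt u v} \<and> agree (For 13 0 compare_prog) s2 s3)"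
        proof (rule runs_For[where T = 6 and N = n and
            I = "\<lambda>u s. word s 18 = card {x. x < u \<and> before wt x v}"])
          fix u s3 assume u: "u < n" "word s3 18 = card {x. x < u \<and> before wt x v}" "word s3 13 = u"
            and ag2: "agree (For 13 0 compare_prog) s2 s3"
          note agreeD[OF ag2, simp]
          have "card {x. x < u \<and> before wt x v} \<le> card {..<u}" by (rule card_mono) auto
          then have "Suc (card {x. x < u \<and> before wt x v}) < 2 ^ w" using u(1) s(3) by simp
          then show "runs w V compare_prog s3 6 (\<lambda>s. word s 18 = card {x. x < Suc u \<and> before wt x v})"
            unfolding compare_step using u v s
            by (intro runs_wp_le) (auto simp: compare_prog_def s2 before_def)
        qed (use s v in \<open>auto simp: s2 compare_prog_def\<close>)
        fix s3 assume s3: "word s3 18 = card {u. u < n \<and> before wt u v} \<and> agree (For 13 0 compare_prog) s2 s3"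
        then have ag2: "agree (For 13 0 compare_prog) s2 s3" by simp
        note agreeD[OF ag2, simp]
        have r: "word s3 18 = rank n wt v" using s3 by (simp add: rank_def)
        \<comment> \<open>Ranks are distinct, so storing v leaves the entries of earlier vertices
          intact.\<close>
        have "rank n wt u \<noteq> rank n wt v" if "u < v" for u
          using that v(1) vertex_at_rank[of u n wt] vertex_at_rank[of v n wt] by auto
        then show "runs w V (WStore 1 18 12) s3 1 (?I (Suc v))"
          using v r by (intro runs_wp_le) (auto simp: s2 compare_prog_def less_Suc_eq)
      qed simp
    qed simp
  qed (use s in \<open>auto simp: compare_prog_def\<close>)
  then show ?thesis
    by (rule runs_mono) (auto, metis vertex_at)
qed

section \<open>Correctness of the program\<close>

lemma pair_index:
  fixes i j k :: nat
  assumes "i < k" "j < k"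
  shows "i * k + j < k * k"
proof -
  have "i * k + j < Suc i * k" using assms by simp
  also have "\<dots> \<le> k * k" using assms by (intro mult_le_mono1) simp
  finally show ?thesis .
qed

text \<open>The word length leaves room for all indices into the padded matrix and for the sums and
  products formed on the way. \<open>V2\<close> and \<open>V3\<close> admit the only values that the
  search computes: partial and full weights of triples.\<close>

locale blocks =
  fixes n m M w :: nat and V :: "real set" and E :: "nat set set" and wt :: "nat \<Rightarrow> real"
  assumes n: "1 \<le> n" and m: "1 \<le> m" and M: "M = m * m" and nM: "n \<le> M"
    and word_length: "4 * ((M + 2) * (M + 2)) < 2 ^ w"
    and E: "simple_graph n E"
    and V2: "\<And>u v. u < n \<Longrightarrow> v < n \<Longrightarrow> wt u + wt v \<in> V"
    and V3: "\<And>u v x. u < n \<Longrightarrow> v < n \<Longrightarrow> x < n \<Longrightarrow> wt u + wt v + wt x \<in> V"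
begin

text \<open>The arguments are positions in the sorted sequence, not vertices. Positions from n on
  are the padding and have no neighbours.\<close>

definition adj :: "nat \<Rightarrow> nat \<Rightarrow> bool" where
  "adj i j \<longleftrightarrow> i < n \<and> j < n \<and> {vertex_at n wt i, vertex_at n wt j} \<in> E"

definition weight_at :: "nat \<Rightarrow> real" where
  "weight_at i = wt (vertex_at n wt i)"

lemma adj_sym: "adj i j \<longleftrightarrow> adj j i"
  by (auto simp: adj_def insert_commute)

lemma weight_at_mono: "i \<le> j \<Longrightarrow> j < n \<Longrightarrow> weight_at i \<le> weight_at j"
  by (simp add: weight_at_def vertex_at_sorted)

definition loaded :: "state \<Rightarrow> bool" where
  "loaded s \<longleftrightarrow> word s 0 = n \<and> word s 4 = 1 \<and> word s 5 = 0 \<and> word s 6 = m \<and> word s 7 = M \<and>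
    word s 8 = m + 1 \<and> word s 11 = M * M \<and>
    (\<forall>i<n. \<forall>j<n. word_arr s 0 (i * n + j) = of_bool ({i, j} \<in> E)) \<and>
    (\<forall>i<n. val_arr s 0 i = wt i)"

definition ready :: "state \<Rightarrow> bool" where
  "ready s \<longleftrightarrow> loaded s \<and> (\<forall>i<n. word_arr s 1 i = vertex_at n wt i) \<and>
    (\<forall>i<M. \<forall>j<M. word_arr s 2 (i * M + j) = of_bool (adj i j))"

lemma loadedD:
  assumes "loaded s"
  shows "word s 0 = n" "word s 4 = 1" "word s 5 = 0" "word s 6 = m" "word s 7 = M"
    "word s 8 = Suc m" "word s 11 = M * M"
    "\<And>i j. i < n \<Longrightarrow> j < n \<Longrightarrow> word_arr s 0 (i * n + j) = of_bool ({i, j} \<in> E)"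
    "\<And>i. i < n \<Longrightarrow> val_arr s 0 i = wt i"
  using assms by (auto simp: loaded_def)

lemma readyD:
  assumes "ready s"
  shows "loaded s" "\<And>i. i < n \<Longrightarrow> word_arr s (Suc 0) i = vertex_at n wt i"
    "\<And>i j. i < M \<Longrightarrow> j < M \<Longrightarrow> word_arr s 2 (i * M + j) = of_bool (adj i j)"
  using assms by (auto simp: ready_def)

lemma loaded_agree:
  "loaded s \<Longrightarrow> agree p s s' \<Longrightarrow> words_written p \<inter> {0, 4, 5, 6, 7, 8, 11} = {} \<Longrightarrow>
    0 \<notin> word_arrs_written p \<Longrightarrow> 0 \<notin> val_arrs_written p \<Longrightarrow> loaded s'"
  unfolding loaded_def by (auto simp: agreeD)

lemma ready_agree:
  "ready s \<Longrightarrow> agree p s s' \<Longrightarrow> words_written p \<inter> {0, 4, 5, 6, 7, 8, 11} = {} \<Longrightarrow>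
    word_arrs_written p \<inter> {0, 1, 2} = {} \<Longrightarrow> 0 \<notin> val_arrs_written p \<Longrightarrow> ready s'"
  unfolding ready_def using loaded_agree[of s p s'] by (auto simp: agreeD)

lemma word_bound: "x \<le> 4 * ((M + 2) * (M + 2)) \<Longrightarrow> x < 2 ^ w"
  using word_length by simp

lemma M_bounds: "m \<le> M" "1 \<le> M" "M \<le> M * M"
  using m M by auto

lemma word_bounds:
  "x \<le> M * M \<Longrightarrow> x < 2 ^ w" "x \<le> 2 * M \<Longrightarrow> x < 2 ^ w" "x \<le> M \<Longrightarrow> x < 2 ^ w" "x \<le> Suc m \<Longrightarrow> x < 2 ^ w"
  using M_bounds by (intro word_bound; simp add: algebra_simps)+

lemma size_bounds: "n < 2 ^ w" "m < 2 ^ w" "M < 2 ^ w" "M * M < 2 ^ w" "Suc m < 2 ^ w" "Suc 0 < 2 ^ w"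
  using M_bounds n nM m by - (rule word_bounds(1) word_bounds(4), linarith)+

lemma pos_bound [simp]: "0 < (2::nat) ^ w"
  by simp

lemma block_index: "i < m \<Longrightarrow> x < m \<Longrightarrow> i * m + x < M"
  unfolding M by (rule pair_index)

lemma matrix_index: "i < M \<Longrightarrow> j < M \<Longrightarrow> i * M + j < M * M"
  by (rule pair_index)

lemma block_div_mod: "e < M \<Longrightarrow> e div m < m" "e mod m < m"
  using m by (auto simp: M less_mult_imp_div_less)

lemma matrix_div_mod: "e < M * M \<Longrightarrow> e div M < M" "e mod M < M"
  using M_bounds by (auto simp: less_mult_imp_div_less)

lemma matrix_prog_correct:
  assumes s: "loaded s" "\<And>i. i < n \<Longrightarrow> word_arr s 1 i = vertex_at n wt i"
  shows "runs w V matrix_prog s (M * M * 15 + 2) (\<lambda>s'. ready s' \<and> agree matrix_prog s s')"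
proof -
  let ?I = "\<lambda>k s'. \<forall>e<k. word_arr s' 2 e = of_bool (adj (e div M) (e mod M))"
  have "runs w V matrix_prog s (M * M * 15 + 2) (\<lambda>s'. ?I (M * M) s' \<and> agree matrix_prog s s')"
    unfolding matrix_prog_def
  proof (rule runs_For[where T = 13 and N = "M * M" and I = ?I], goal_cases)
    \<comment> \<open>The ninth premise of \<open>runs_For\<close>, the loop body; likewise in the
      loops below.\<close>
    case (9 e s1)
    note agreeD[OF 9(4), simp] loadedD[OF s(1), simp]
    have e: "e div M < M" "e mod M < M" using matrix_div_mod 9(1) by auto
    have b: "e div M < 2 ^ w" "e div M * M < 2 ^ w" "e mod M < 2 ^ w"
      using 9(1) e div_times_less_eq_dividend[of e M]
      by (auto intro: word_bounds(3) word_bounds(1) simp del: div_times_less_eq_dividend)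
    have v: "vertex_at n wt (e div M) * n + vertex_at n wt (e mod M) < 2 ^ w"
      "vertex_at n wt (e div M) * n < 2 ^ w" if "e div M < n" "e mod M < n"
    proof -
      have "vertex_at n wt (e div M) * n + vertex_at n wt (e mod M) < n * n"
        using that vertex_at by (intro pair_index) auto
      also have "\<dots> \<le> M * M" using nM by (intro mult_le_mono)
      finally have *: "vertex_at n wt (e div M) * n + vertex_at n wt (e mod M) < M * M" .
      show "vertex_at n wt (e div M) * n + vertex_at n wt (e mod M) < 2 ^ w"
        using * by (intro word_bounds(1)) simp
      show "vertex_at n wt (e div M) * n < 2 ^ w"
        using * by (intro word_bounds(1)) linarith
    qed
    show ?case
      by (rule runs_wp_le)
        (use b v 9(2,3) s e in \<open>auto simp: less_Suc_eq minus_div_mult_eq_mod vertex_at adj_def\<close>)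
  qed (use s in \<open>auto simp: size_bounds loadedD\<close>)
  then show ?thesis
  proof (rule runs_mono, goal_cases)
    case (2 s')
    then have "loaded s'" using loaded_agree[OF s(1)] by (auto simp: matrix_prog_def)
    with 2 s(2) matrix_index show ?case
      by (auto simp: ready_def matrix_prog_def agreeD)
  qed auto
qed

lemma copy_block_correct:
  assumes s: "ready s" "word s r = R" "word s c = C" "R < m" "C < m"
    and rc: "{r, c} \<inter> {15, 18, 19, 23, 24, 25} = {}" and A: "2 < A"
  shows "runs w V (copy_block r c A) s (M * 15 + 2) (\<lambda>s'.
    (\<forall>e<M. word_arr s' A e = of_bool (adj (R * m + e div m) (C * m + e mod m))) \<and>
    agree (copy_block r c A) s s')"
  unfolding copy_block_def
proof (rule runs_For[where T = 13 and N = M], goal_cases)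
  case (9 e s1)
  note agreeD[OF 9(4), simp] loadedD[OF readyD(1)[OF s(1)], simp]
  have e: "e div m < m" "e mod m < m" using block_div_mod 9(1) by auto
  have i: "R * m + e div m < M" "C * m + e mod m < M" using e s block_index by auto
  have j: "(R * m + e div m) * M + (C * m + e mod m) < M * M" using i matrix_index by auto
  have b: "e div m < 2 ^ w" "e div m * m < 2 ^ w" "e mod m < 2 ^ w" "R * m < 2 ^ w"
    "R * m + e div m < 2 ^ w" "C * m < 2 ^ w" "C * m + e mod m < 2 ^ w"
    "(R * m + e div m) * M + (C * m + e mod m) < 2 ^ w" "(R * m + e div m) * M < 2 ^ w"
    using e i j 9(1) div_times_less_eq_dividend[of e m] M_bounds
    by - (rule word_bounds(1), linarith)+
  show ?case
    by (rule runs_wp_le)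
      (use 9(2) s i rc A in \<open>auto simp: b s(2,3) 9(3) less_Suc_eq minus_div_mult_eq_mod readyD\<close>)
qed (use s rc in \<open>auto simp: size_bounds loadedD readyD\<close>)

text \<open>The order of the arguments follows the matrix product: this says that the entry for i
  and j in the product of two blocks meeting in block K is positive.\<close>

definition hit :: "nat \<Rightarrow> nat \<Rightarrow> nat \<Rightarrow> bool" where
  "hit K i j \<longleftrightarrow> (\<exists>y<m. adj i (K * m + y) \<and> adj (K * m + y) j)"

text \<open>K is the number of blocks examined so far, which makes this the invariant of the loop
  over the blocks. The shift of \<open>b\<close> by one reserves 0 for the absence of a hit.\<close>

definition last_hit :: "nat \<Rightarrow> nat \<Rightarrow> nat \<Rightarrow> nat \<Rightarrow> bool" where
  "last_hit K b i j \<longleftrightarrow>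
    b \<le> K \<and> (b > 0 \<longrightarrow> hit (b - 1) i j) \<and> (\<forall>K'. b \<le> K' \<and> K' < K \<longrightarrow> \<not> hit K' i j)"

lemma last_hit_0: "last_hit 0 0 i j"
  by (simp add: last_hit_def)

lemma last_hit_Suc:
  "last_hit K b i j \<Longrightarrow> last_hit (Suc K) (if hit K i j then Suc K else b) i j"
  by (auto simp: last_hit_def less_Suc_eq)

lemma update_prog_correct:
  assumes s: "ready s" "word s 14 = K" "K < m"
    and H: "\<And>e. e < M \<Longrightarrow> 0 < clip (m + 1) (word_arr s 15 e) \<longleftrightarrow> H e"
  shows "runs w V update_prog s (M * 7 + 2) (\<lambda>s'.
    (\<forall>e<M. word_arr s' 3 e = (if H e then Suc K else word_arr s 3 e)) \<and> agree update_prog s s')"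
proof -
  \<comment> \<open>The quantifier is unbounded in order to record that cells not yet visited keep
    their old contents, to which the result falls back.\<close>
  let ?I = "\<lambda>k s'. \<forall>e. word_arr s' 3 e = (if e < k \<and> H e then Suc K else word_arr s 3 e)"
  have "runs w V update_prog s (M * 7 + 2) (\<lambda>s'. ?I M s' \<and> agree update_prog s s')"
    unfolding update_prog_def
  proof (rule runs_For[where T = 5 and N = M and I = ?I], goal_cases)
    case (9 e s1)
    note agreeD[OF 9(4), simp] loadedD[OF readyD(1)[OF s(1)], simp]
    have "Suc K < 2 ^ w" using s M_bounds by (intro word_bounds) simp
    moreover have "H e \<longleftrightarrow> 0 < word_arr s 15 e \<and> word_arr s 15 e < Suc m"
      using H[OF 9(1)] by (auto simp: clip_def split: if_splits)
    ultimately show ?case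
      by (intro runs_wp_le) (use 9(2,3) s in \<open>auto simp: less_Suc_eq\<close>)
  qed (use s in \<open>auto simp: size_bounds loadedD readyD\<close>)
  then show ?thesis by (rule runs_mono) auto
qed

text \<open>The invariant of the search: S contains the pairs of positions already treated. The
  stored weight belongs to an actual triangle and dominates every triangle with an edge in S,
  wherever its third vertex lies.\<close>

definition best :: "state \<Rightarrow> (nat \<times> nat) set \<Rightarrow> bool" where
  "best s S \<longleftrightarrow>
    (word s 22 = 0 \<or> word s 22 = 1 \<and> triangle E (word s 1) (word s 2) (word s 3) \<and>
      val s 3 = triangle_weight wt (word s 1) (word s 2) (word s 3)) \<and>
    (\<forall>i j k. (i, j) \<in> S \<and> adj i j \<and> adj i k \<and> adj j k \<longrightarrow>
      word s 22 = 1 \<and> weight_at i + weight_at j + weight_at k \<le> val s 3)"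

lemma best_cong:
  "word s' 1 = word s 1 \<Longrightarrow> word s' 2 = word s 2 \<Longrightarrow> word s' 3 = word s 3 \<Longrightarrow>
    word s' 22 = word s 22 \<Longrightarrow> val s' 3 = val s 3 \<Longrightarrow> best s' S = best s S"
  by (simp add: best_def)

lemma best_skip:
  "best s S \<Longrightarrow> (\<And>k. adj i j \<Longrightarrow> adj i k \<Longrightarrow> adj j k \<Longrightarrow> False) \<Longrightarrow> best s (insert (i, j) S)"
  unfolding best_def by blast

text \<open>y is the number of offsets of block K scanned so far, and x is the offset of the
  position k within the block.\<close>

definition top_common :: "nat \<Rightarrow> nat \<Rightarrow> nat \<Rightarrow> nat \<Rightarrow> nat \<Rightarrow> nat \<Rightarrow> bool" where
  "top_common K y i j k x \<longleftrightarrow> x < y \<and> k = K * m + x \<and> adj i k \<and> adj j k \<and>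
     (\<forall>x'<y. adj i (K * m + x') \<and> adj j (K * m + x') \<longrightarrow> x' \<le> x)"

text \<open>If the block contains no common neighbour, word 27 carries no information, hence the
  disjunction. The caller excludes that case by its knowledge of the block.\<close>

lemma scan_block_prog_correct:
  assumes s: "ready s" "word s 23 = K * m" "word s 24 = i" "word s 25 = j" "K < m" "i < M" "j < M"
  shows "runs w V scan_block_prog s (m * 12 + 2) (\<lambda>s'.
    ((\<forall>x<m. \<not> (adj i (K * m + x) \<and> adj j (K * m + x))) \<or>
     (\<exists>x. top_common K m i j (word s' 27) x)) \<and> agree scan_block_prog s s')"
  unfolding scan_block_prog_def
proof (rule runs_For[where T = 10 and N = m and I =
    "\<lambda>y s'. (\<forall>x<y. \<not> (adj i (K * m + x) \<and> adj j (K * m + x))) \<or>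
     (\<exists>x. top_common K y i j (word s' 27) x)"], goal_cases)
  case (9 y s1)
  note agreeD[OF 9(4), simp] loadedD[OF readyD(1)[OF s(1)], simp]
  have k: "K * m + y < M" using 9(1) s block_index by auto
  have ij: "i * M + (K * m + y) < M * M" "j * M + (K * m + y) < M * M"
    using k s matrix_index by auto
  have b: "K * m + y < 2 ^ w" "i * M + (K * m + y) < 2 ^ w" "j * M + (K * m + y) < 2 ^ w"
     "i * M < 2 ^ w" "j * M < 2 ^ w"
    using k ij M_bounds by - (rule word_bounds(1), linarith)+
  have step: "(\<forall>x<Suc y. \<not> (adj i (K * m + x) \<and> adj j (K * m + x))) \<or>
     (\<exists>x. top_common K (Suc y) i j k x)"
    if "k = (if adj i (K * m + y) \<and> adj j (K * m + y) then K * m + y else word s1 27)" for k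
    using 9(2) that unfolding top_common_def
    by (cases "adj i (K * m + y) \<and> adj j (K * m + y)") (auto simp: less_Suc_eq)
  show ?case
    by (rule runs_wp_le)
      (use step in \<open>auto simp: b s(2-) 9(3) readyD[OF s(1)] k\<close>)
qed (use s in \<open>auto simp: size_bounds loadedD readyD\<close>)

text \<open>Weights increase with positions, so the largest common neighbour k gives the heaviest
  triangle on the edge from i to j. Comparing this single candidate settles the pair for all third
  vertices.\<close>

lemma candidate_prog_correct:
  assumes s: "ready s" "word s 24 = i" "word s 25 = j" "word s 27 = k"
    and ijk: "adj i j" "adj i k" "adj j k"
    and k: "\<And>k'. adj i k' \<Longrightarrow> adj j k' \<Longrightarrow> k' \<le> k"
    and best: "best s S"
  shows "runs w V candidate_prog s 17 (\<lambda>s'. best s' (insert (i, j) S))"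
proof -
  note loadedD[OF readyD(1)[OF s(1)], simp]
  have less: "i < n" "j < n" "k < n" using ijk by (auto simp: adj_def)
  let ?x = "vertex_at n wt i" and ?y = "vertex_at n wt j" and ?z = "vertex_at n wt k"
  have xyz: "?x < n" "?y < n" "?z < n" using less vertex_at by auto
  have V: "wt ?x + wt ?y \<in> V" "wt ?x + wt ?y + wt ?z \<in> V" using V2 V3 xyz by auto
  have tri: "triangle E ?x ?y ?z" using ijk by (auto simp: triangle_def adj_def)
  have b: "?x < 2 ^ w" "?y < 2 ^ w" "?z < 2 ^ w"
    using xyz nM M_bounds by (auto intro!: word_bounds(3))
  let ?T = "wt ?x + wt ?y + wt ?z"
  have ub: "weight_at i + weight_at j + weight_at k' \<le> ?T" if "adj i k'" "adj j k'" for k'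
  proof -
    have "weight_at k' \<le> weight_at k" by (rule weight_at_mono[OF k[OF that] less(3)])
    then show ?thesis by (simp add: weight_at_def)
  qed
  have old_bound: "word s 22 = 1 \<and> weight_at i' + weight_at j' + weight_at k' \<le> val s 3"
    if "(i', j') \<in> S" "adj i' j'" "adj i' k'" "adj j' k'" for i' j' k'
    using best that unfolding best_def by blast
  have new: "best s' (insert (i, j) S)"
    if s': "word s' 22 = 1" "word s' 1 = ?x" "word s' 2 = ?y" "word s' 3 = ?z" "val s' 3 = ?T"
      and less: "word s 22 = 0 \<or> val s 3 < ?T" for s'
    unfolding best_def
  proof (intro conjI allI impI)
    fix i' j' k' assume *: "(i', j') \<in> insert (i, j) S \<and> adj i' j' \<and> adj i' k' \<and> adj j' k'"
    show "weight_at i' + weight_at j' + weight_at k' \<le> val s' 3"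
    proof (cases "(i', j') = (i, j)")
      case True
      then show ?thesis using * ub s' by auto
    next
      case False
      then show ?thesis using * old_bound[of i' j' k'] less s'(5) by auto
    qed
  qed (use s' tri in \<open>simp_all add: triangle_weight_def\<close>)
  have old: "best s' (insert (i, j) S)"
    if s': "word s' 22 = word s 22" "word s' 1 = word s 1" "word s' 2 = word s 2"
      "word s' 3 = word s 3" "val s' 3 = val s 3"
      and ge: "0 < word s 22" "\<not> val s 3 < ?T" for s'
  proof -
    have "best s (insert (i, j) S)" unfolding best_def
    proof (intro conjI allI impI)
      fix i' j' k' assume *: "(i', j') \<in> insert (i, j) S \<and> adj i' j' \<and> adj i' k' \<and> adj j' k'"
      show "weight_at i' + weight_at j' + weight_at k' \<le> val s 3"
      proof (cases "(i', j') = (i, j)")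
        case True
        then show ?thesis using * ub[of k'] ge(2) by auto
      next
        case False
        then show ?thesis using * old_bound by auto
      qed
    qed (use best ge(1) in \<open>auto simp: best_def\<close>)
    then show ?thesis using best_cong[OF s'(2-4,1,5)] by blast
  qed
  show ?thesis
  proof (cases "word s 22 = 0 \<or> val s 3 < ?T")
    case True
    show ?thesis
      by (rule runs_wp_le; simp add: candidate_prog_def s b V readyD[OF s(1)] xyz less size_bounds)
        (use True in \<open>auto intro!: new\<close>)
  next
    case False
    show ?thesis
      by (rule runs_wp_le; simp add: candidate_prog_def s b V readyD[OF s(1)] xyz less size_bounds)
        (use False in \<open>auto intro!: old\<close>)
  qed
qed

end

section \<open>Finding the last blocks by products of blocks\<close>

locale blocks_mult = blocks +
  fixes p :: prog and Tm :: nat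
  assumes arith: "arithmetic p"
    and mult: "\<And>A B s. \<lbrakk>word s 5 = 0; word s 8 = m + 1; word s 100 = m;
      \<And>i j. i < m \<Longrightarrow> j < m \<Longrightarrow> word_arr s 11 (i * m + j) = A i j \<and> A i j \<le> 1;
      \<And>i j. i < m \<Longrightarrow> j < m \<Longrightarrow> word_arr s 13 (i * m + j) = B i j \<and> B i j \<le> 1\<rbrakk> \<Longrightarrow>
      runs w V (mod_prog p) s Tm (\<lambda>s'. \<forall>i<m. \<forall>j<m.
        clip (m + 1) (word_arr s' 15 (i * m + j)) = (\<Sum>k<m. A i k * B k j :: nat))"
begin

lemma witness_block_written [simp]:
  "d < 100 \<Longrightarrow> d \<noteq> 9 \<Longrightarrow> d \<noteq> 10 \<Longrightarrow>
    d \<in> words_written (witness_block_prog p) \<longleftrightarrow> d \<in> {14, 15, 18, 19, 23, 24, 25, 31}"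
  "vals_written (witness_block_prog p) = {}"
  "A < 10 \<Longrightarrow> A \<in> word_arrs_written (witness_block_prog p) \<longleftrightarrow> A = 3"
  "val_arrs_written (witness_block_prog p) = {}"
  using mod_prog_not_written[OF arith] mod_prog_written[OF arith]
  by (auto simp: witness_block_prog_def)

text \<open>In the time bound, 37 * M is made up of two copies at 15 * M each and an update at 7 *
  M.\<close>

lemma witness_block_prog_correct:
  assumes s: "ready s" "word s 20 = I" "word s 21 = J" "I < m" "J < m"
    and clear: "\<And>e. e < M \<Longrightarrow> word_arr s 3 e = 0"
  shows "runs w V (witness_block_prog p) s (m * (Tm + 37 * M + 9) + 2) (\<lambda>s'.
    (\<forall>e<M. last_hit m (word_arr s' 3 e) (I * m + e div m) (J * m + e mod m)) \<and>
    agree (witness_block_prog p) s s')"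
  unfolding witness_block_prog_def
proof (rule runs_For[where T = "Tm + 37 * M + 7" and N = m and I =
    "\<lambda>K s'. \<forall>e<M. last_hit K (word_arr s' 3 e) (I * m + e div m) (J * m + e mod m)"], goal_cases)
  case (9 K s1)
  note ag1 = 9(4)[folded witness_block_prog_def]
  note notw [simp] = mod_prog_not_written[OF arith] mod_prog_written[OF arith]
  have r1: "ready s1" using s(1) ag1 by (rule ready_agree) auto
  have w1: "word s1 20 = I" "word s1 21 = J" "word s1 14 = K"
    using 9(3) s ag1 by (auto simp: agreeD)
  let ?A = "\<lambda>i k. of_bool (adj (I * m + i) (K * m + k)) :: nat"
  let ?B = "\<lambda>k j. of_bool (adj (K * m + k) (J * m + j)) :: nat"
  show ?case
  proof (rule runs_Seq_le[OF copy_block_correct[OF r1 w1(1,3) s(4) 9(1)],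
        where T' = "(M * 15 + 2) + (1 + (Tm + (M * 7 + 2)))"], goal_cases)
    case (3 s2)
    then have ag2: "agree (copy_block 20 14 11) s1 s2" and A: "\<forall>e<M. word_arr s2 11 e = ?A (e div m) (e mod m)"
      by auto
    have r2: "ready s2" using r1 ag2 by (rule ready_agree) auto
    have w2: "word s2 21 = J" "word s2 14 = K" using w1 ag2 by (auto simp: agreeD)
    show ?case
    proof (rule runs_Seq_le[OF copy_block_correct[OF r2 w2(2,1) 9(1) s(5)],
          where T' = "1 + (Tm + (M * 7 + 2))"], goal_cases)
      case (3 s3)
      then have ag3: "agree (copy_block 14 21 13) s2 s3" and B: "\<forall>e<M. word_arr s3 13 e = ?B (e div m) (e mod m)"
        by auto
      have r3: "ready s3" using r2 ag3 by (rule ready_agree) auto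
      note l3 = loadedD[OF readyD(1)[OF r3]]
      have A3: "word_arr s3 11 = word_arr s2 11" using ag3 by (auto simp: agreeD)
      show ?case
      proof (rule runs_Seq_le[where T = 1 and R = "\<lambda>s4. s4 = set_word 100 m s3"
            and T' = "Tm + (M * 7 + 2)"], goal_cases)
        case 1
        show ?case by (rule runs_wp_le) (use l3 in \<open>auto simp: size_bounds\<close>)
      next
        case (2 s4)
        have div: "(i * m + j) div m = i" "(i * m + j) mod m = j" if "j < m" for i j
          using that by auto
        have "runs w V (mod_prog p) s4 Tm (\<lambda>s'. \<forall>i<m. \<forall>j<m.
            clip (m + 1) (word_arr s' 15 (i * m + j)) = (\<Sum>k<m. ?A i k * ?B k j))"
          by (rule mult) (use 2 l3 A A3 B block_index div in auto)
        from runs_agree[OF this] show ?case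
        proof (rule runs_Seq_le[where T' = "M * 7 + 2"], goal_cases)
          case (1 s5)
          then have ag5: "agree (mod_prog p) s4 s5" by simp
          have r4: "ready s4" using r3 by (auto simp: 2 ready_def loaded_def)
          have r5: "ready s5" using r4 ag5 by (rule ready_agree) (use mod_prog_written[OF arith] in auto)
          have w5: "word s5 14 = K" using ag5 ag3 w2 by (auto simp: 2 agreeD)
          have s5: "word_arr s5 3 = word_arr s1 3" using ag5 ag3 ag2 by (auto simp: 2 agreeD)
          \<comment> \<open>A sum of products of 0-1 entries is positive exactly if some index
            contributes, and such an index is a common neighbour in block K.\<close>
          have H: "0 < clip (m + 1) (word_arr s5 15 e) \<longleftrightarrow> hit K (I * m + e div m) (J * m + e mod m)"
            if "e < M" for e
          proof -
            have "clip (m + 1) (word_arr s5 15 (e div m * m + e mod m)) =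
              (\<Sum>k<m. ?A (e div m) k * ?B k (e mod m))"
              using 1 block_div_mod(1)[OF that] block_div_mod(2) by blast
            then show ?thesis by (auto simp: hit_def zero_less_iff_neq_zero simp del: of_bool_conj)
          qed
          show ?case
            by (rule runs_mono[OF update_prog_correct[OF r5 w5 9(1) H]])
              (use s5 9(2) last_hit_Suc in auto)
        qed simp
      next
        case 3 show ?case by simp
      qed
    qed auto
  qed auto
qed (use s clear last_hit_0 in \<open>auto simp: size_bounds loadedD readyD mod_prog_not_written[OF arith]\<close>)

end

context blocks
begin

text \<open>The block of k is hit, and \<open>last_hit\<close> excludes hits from b on. For b = 0
  this rules out common neighbours altogether.\<close>

lemma common_block:
  assumes "last_hit m b i j" "adj i k" "adj j k"
  shows "k div m < b"
proof (rule ccontr)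
  assume "\<not> ?thesis"
  moreover have km: "k < M" using assms(2) nM by (simp add: adj_def)
  have "hit (k div m) i j"
    unfolding hit_def using assms(2,3) adj_sym[of j k] m
    by (intro exI[of _ "k mod m"]) simp
  ultimately show False using assms(1) block_div_mod(1)[OF km] by (simp add: last_hit_def)
qed

text \<open>Any common neighbour lies either in block b - 1, where the scan has found the largest
  one, or in an earlier block, all of whose positions are smaller.\<close>

lemma top_common_max:
  assumes "top_common (b - 1) m i j k x" "last_hit m b i j" "adj i k'" "adj j k'"
  shows "k' \<le> k"
proof (cases "k' div m = b - 1")
  case True
  then have k': "k' = (b - 1) * m + k' mod m" by (metis div_mult_mod_eq)
  have "k' mod m < m" using m by simp
  then have "k' mod m \<le> x" using assms(1,3,4) k' unfolding top_common_def by metis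
  then show ?thesis using assms(1) k' unfolding top_common_def by linarith
next
  case False
  then have "k' div m < b - 1" using common_block[OF assms(2-4)] by simp
  then have "k' < (b - 1) * m" using m by (simp add: div_less_iff_less_mult)
  then show ?thesis using assms(1) by (simp add: top_common_def)
qed

lemma pair_prog_correct:
  assumes s: "ready s" "word s 20 = I" "word s 21 = J" "word s 15 = e" "I < m" "J < m" "e < M"
    and b: "last_hit m (word_arr s 3 e) (I * m + e div m) (J * m + e mod m)"
    and best: "best s S"
  shows "runs w V pair_prog s (12 * m + 35)
    (\<lambda>s'. best s' (insert (I * m + e div m, J * m + e mod m) S))"
proof -
  let ?i = "I * m + e div m" and ?j = "J * m + e mod m" and ?b = "word_arr s 3 e"
  note l = loadedD[OF readyD(1)[OF s(1)]]
  have e: "e div m < m" "e mod m < m" using block_div_mod s by auto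
  have ij: "?i < M" "?j < M" using e s block_index by auto
  have skip: "runs w V skip s1 1 (\<lambda>s'. best s' (insert (?i, ?j) S))"
    if "best s1 S" "\<And>k. adj ?i ?j \<Longrightarrow> adj ?i k \<Longrightarrow> adj ?j k \<Longrightarrow> False" for s1
  proof (rule runs_wp_le)
    have "best s1 (insert (?i, ?j) S)" using that by (rule best_skip)
    then show "wp w V skip (\<lambda>s'. best s' (insert (?i, ?j) S)) s1" by (simp add: best_def)
  qed simp
  show ?thesis unfolding pair_prog_def
  proof (rule runs_Seq_le[where T = 1 and T' = "12 * m + 34" and R = "\<lambda>s1. s1 = set_word 23 ?b s"],
      goal_cases)
    case 1
    show ?case by (rule runs_wp_le) (use s in auto)
  next
    case (2 s1)
    have best1: "best s1 S" using best 2 by (simp add: best_def)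
    show ?case
    proof (rule runs_Cond_le[where T = "12 * m + 33"], goal_cases)
      case 1
      then have pos: "0 < ?b" using 2 l by simp
      then have bm: "?b - 1 < m" using b by (auto simp: last_hit_def)
      have bb: "I * m < 2 ^ w" "J * m < 2 ^ w" "e div m * m < 2 ^ w" "e div m < 2 ^ w" "e mod m < 2 ^ w"
        "?i < 2 ^ w" "?j < 2 ^ w" "?i * M + ?j < 2 ^ w" "?i * M < 2 ^ w"
        using e ij matrix_index[OF ij] div_times_less_eq_dividend[of e m] M_bounds s(7)
        by - (rule word_bounds(1), linarith)+
      show ?case
      proof (rule runs_Seq_le[where T' = "12 * m + 23"], rule runs_agree, rule runs_wp_le[where T = 10 and
          Q = "\<lambda>s2. word s2 26 = of_bool (adj ?i ?j) \<and> word s2 24 = ?i \<and> word s2 25 = ?j"],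
          goal_cases)
        case 1
        show ?case
          by (simp add: 2 bb s(2-4) l readyD[OF s(1)] ij minus_div_mult_eq_mod)
      next
        case (3 s2)
        then have s2: "word s2 26 = of_bool (adj ?i ?j)" "word s2 24 = ?i" "word s2 25 = ?j"
          and ag: "\<And>d. d \<notin> {18, 19, 24, 25, 26} \<Longrightarrow> word s2 d = word s1 d" "val s2 = val s1"
            "word_arr s2 = word_arr s1" "val_arr s2 = val_arr s1"
          by (auto simp: agree_def)
        have r2: "ready s2" using s(1) ag 2 by (simp add: ready_def loaded_def)
        have best2: "best s2 S" using best1 ag by (simp add: best_def)
        show ?case
        proof (rule runs_Cond_le[where T = "12 * m + 22"], goal_cases)
          case 1
          then have adj: "adj ?i ?j" using s2 l ag 2 by (auto split: if_splits)
          have less: "(?b - 1) * m < 2 ^ w" "?b - 1 < 2 ^ w"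
            using block_index[OF bm, of 0] bm m M_bounds by - (rule word_bounds(1), linarith)+
          show ?case
          proof (rule runs_Seq_le[where T = 3 and T' = "12 * m + 19" and
              R = "\<lambda>s3. s3 = set_word 27 0 (set_word 23 ((?b - 1) * m) (set_word 23 (?b - 1) s2))"], goal_cases)
            case 1
            show ?case
              by (rule runs_wp_le) (use less ag 2 l in auto)
          next
            case (2 s3)
            have r3: "ready s3" using r2 2 by (simp add: ready_def loaded_def)
            have best3: "best s3 S" using best2 2 by (simp add: best_def)
            have w3: "word s3 23 = (?b - 1) * m" "word s3 24 = ?i" "word s3 25 = ?j"
              using s2 2 by auto
            show ?case
            proof (rule runs_Seq_le[OF scan_block_prog_correct[OF r3 w3 bm ij], where T' = 17], goal_cases)
              case (1 s4)
              then have ag4: "agree scan_block_prog s3 s4" by simp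
              have r4: "ready s4" using r3 ag4 by (rule ready_agree) auto
              have w4: "word s4 24 = ?i" "word s4 25 = ?j" using ag4 w3 by (auto simp: agreeD)
              have "best s4 S = best s3 S" by (rule best_cong) (use ag4 in \<open>auto simp: agreeD\<close>)
              then have best4: "best s4 S" using best3 by simp
              \<comment> \<open>A hit in the scanned block excludes the first outcome of the scan;
                symmetry of \<open>adj\<close> reconciles the two forms of being a common
                neighbour.\<close>
              have "hit (?b - 1) ?i ?j" using b pos by (simp add: last_hit_def)
              with 1 adj_sym obtain x where x: "top_common (?b - 1) m ?i ?j (word s4 27) x"
                unfolding hit_def by blast
              show ?case
                using x adj top_common_max[OF x b] best4
                by (intro candidate_prog_correct[OF r4 w4 refl]) (auto simp: top_common_def)
            qed simp
          qed simp
        next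
          case 2
          then have "\<not> adj ?i ?j" using s2 l ag \<open>s1 = _\<close> by auto
          then show ?case by (intro runs_mono[OF skip[OF best2]]) auto
        qed simp
      qed simp_all
    next
      case 2
      then have "?b = 0" using \<open>s1 = _\<close> l by simp
      then show ?case using common_block[OF b]
        by (intro runs_mono[OF skip[OF best1]]) auto
    qed simp
  qed simp
qed

text \<open>Pairs of positions are enumerated block by block: d encodes a pair of blocks and e a
  pair of offsets within them.\<close>

definition cell :: "nat \<Rightarrow> nat \<Rightarrow> nat \<times> nat" where
  "cell d e = (d div m * m + e div m, d mod m * m + e mod m)"

text \<open>The quotients of i and j by m combine to d, the remainders to e.\<close>

lemma all_cells:
  assumes "i < M" "j < M"
  shows "\<exists>d<M. \<exists>e<M. (i, j) = cell d e"
proof (intro exI conjI)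
  have "i div m < m" "j div m < m" "i mod m < m" "j mod m < m"
    using assms block_div_mod by auto
  then show "i div m * m + j div m < M" "i mod m * m + j mod m < M"
    "(i, j) = cell (i div m * m + j div m) (i mod m * m + j mod m)"
    using block_index by (auto simp: cell_def)
qed

lemma clear_prog_correct:
  assumes s: "ready s"
  shows "runs w V clear_prog s (M * 3 + 2)
    (\<lambda>s'. (\<forall>e<M. word_arr s' 3 e = 0) \<and> agree clear_prog s s')"
  unfolding clear_prog_def
proof (rule runs_For[where T = 1 and N = M and I = "\<lambda>k s'. \<forall>e<k. word_arr s' 3 e = 0"], goal_cases)
  case (9 e s1)
  note agreeD[OF 9(4), simp] loadedD[OF readyD(1)[OF s(1)], simp]
  show ?case by (rule runs_wp_le) (use 9(2,3) in \<open>auto simp: less_Suc_eq\<close>)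
qed (use s in \<open>auto simp: size_bounds loadedD readyD\<close>)

text \<open>The loop stops no later than at m because n \<le> M, and no earlier because m is least;
  the first fact also keeps the squares within a word.\<close>

lemma init_prog_correct:
  assumes s: "encodes_graph s n E wt" and least: "\<And>k. n \<le> k * k \<Longrightarrow> m \<le> k"
  shows "runs w V init_prog s (3 * m + 7) loaded"
proof -
  let ?body = "Seq (WOp WAdd 6 6 4) (WOp WMul 7 6 6)"
  let ?I = "\<lambda>s'. word s' 0 = n \<and> word s' 4 = 1 \<and> word s' 5 = 0 \<and> word s' 7 = word s' 6 * word s' 6 \<and>
    word s' 6 \<le> m \<and> word_arr s' = word_arr s \<and> val_arr s' = val_arr s"
  have loop: "runs w V (Loop (WLess 7 0) ?body) s1 ((m - word s1 6) * (2 + 1) + 1)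
    (\<lambda>s'. ?I s' \<and> \<not> holds (WLess 7 0) s')" if "?I s1" for s1
  proof (rule runs_Loop[where I = ?I and f = "\<lambda>s'. m - word s' 6"])
    fix s2 assume I: "?I s2" and h: "holds (WLess 7 0) s2"
    have less: "word s2 6 < m"
    proof (rule ccontr)
      assume "\<not> ?thesis"
      then have "word s2 7 = M" using I M by simp
      then show False using h I nM by simp
    qed
    then have "Suc (word s2 6) * Suc (word s2 6) \<le> m * m" by (intro mult_le_mono) auto
    then have "Suc (word s2 6) * Suc (word s2 6) < 2 ^ w"
      using M by (intro word_bounds(3)) simp
    moreover have "Suc (word s2 6) < 2 ^ w" using less size_bounds(2) by simp
    ultimately show "runs w V ?body s2 2 (\<lambda>s'. ?I s' \<and> m - word s' 6 < m - word s2 6)"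
      by (intro runs_wp_le) (use I less in auto)
  qed (use that in auto)
  show ?thesis unfolding init_prog_def
  proof (rule runs_Seq_le[where T = 4 and T' = "3 * m + 3" and R = "\<lambda>s1. ?I s1 \<and> word s1 6 = 0"], goal_cases)
    case 1
    show ?case by (rule runs_wp_le) (use s in \<open>auto simp: encodes_graph_def size_bounds\<close>)
  next
    case (2 s1)
    then have "?I s1" by simp
    from loop[OF this] show ?case
    proof (rule runs_Seq_le[where T' = 2], goal_cases)
      case (1 s2)
      then have "m \<le> word s2 6" by (intro least) auto
      then have "word s2 6 = m" "word s2 7 = M" using 1 M by auto
      then show ?case
        by (intro runs_wp_le) (use 1 s in \<open>auto simp: encodes_graph_def size_bounds loaded_def\<close>)
    qed (use 2 in simp)
  qed simp
qed

end

section \<open>The whole search and its cost\<close>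

context blocks_mult
begin

text \<open>Each of the M pairs of blocks costs one clearing of the witness array, m products and M
  scans of length m. This amounts to m^3 products in total and O(m^5) further steps.\<close>

lemma search_prog_correct:
  assumes s: "ready s" "word s 22 = 0"
  shows "runs w V (search_prog p) s
    (M * (m * (Tm + 37 * M + 9) + M * (12 * m + 37) + M * 3 + 11) + 2)
    (\<lambda>s'. best s' {cell d e | d e. d < M \<and> e < M})"
proof -
  let ?S = "\<lambda>d. {cell d' e | d' e. d' < d \<and> e < M}"
  let ?T = "m * (Tm + 37 * M + 9) + M * (12 * m + 37) + M * 3 + 9"
  have "runs w V (search_prog p) s (M * (?T + 2) + 2) (\<lambda>s'. best s' (?S M) \<and> agree (search_prog p) s s')"
    unfolding search_prog_def
  proof (rule runs_For[where T = ?T and N = M and I = "\<lambda>d s'. best s' (?S d)"], goal_cases)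
    case (8 d x s1)
    then show ?case by (simp add: best_def)
  next
    case (9 d s1)
    note notw = mod_prog_not_written[OF arith] mod_prog_written[OF arith]
    have r1: "ready s1" using s(1) 9(4) by (rule ready_agree) (auto simp: notw)
    note l1 = loadedD[OF readyD(1)[OF r1]]
    have d: "d div m < m" "d mod m < m" using block_div_mod 9(1) by auto
    have b: "d div m < 2 ^ w" "d div m * m < 2 ^ w" "d mod m < 2 ^ w"
      using d 9(1) div_times_less_eq_dividend[of d m] M_bounds by - (rule word_bounds(1), linarith)+
    show ?case
    proof (rule runs_Seq_le[where T' = "(M * 3 + 2) + ((m * (Tm + 37 * M + 9) + 2) + (M * (12 * m + 37) + 2))"],
        rule runs_agree, rule runs_wp_le[where T = 3 and Q = "\<lambda>s2. word s2 20 = d div m \<and> word s2 21 = d mod m"],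
        goal_cases)
      case 1
      show ?case by (simp add: b 9(3) l1 minus_div_mult_eq_mod)
    next
      case (3 s2)
      then have w2: "word s2 20 = d div m" "word s2 21 = d mod m"
        and ag2: "agree (Seq (WOp WDiv 20 12 6) (Seq (WOp WMul 21 20 6) (WOp WSub 21 12 21))) s1 s2"
        by auto
      have r2: "ready s2" using r1 ag2 by (rule ready_agree) auto
      have "best s2 (?S d) = best s1 (?S d)" by (rule best_cong) (use ag2 in \<open>auto simp: agreeD\<close>)
      then have best2: "best s2 (?S d)" using 9(2) by simp
      show ?case
      proof (rule runs_Seq_le[OF clear_prog_correct[OF r2], where
          T' = "(m * (Tm + 37 * M + 9) + 2) + (M * (12 * m + 37) + 2)"], goal_cases)
        case (1 s3)
        then have z3: "\<And>e. e < M \<Longrightarrow> word_arr s3 3 e = 0" and ag3: "agree clear_prog s2 s3" by auto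
        have r3: "ready s3" using r2 ag3 by (rule ready_agree) auto
        have w3: "word s3 20 = d div m" "word s3 21 = d mod m" using w2 ag3 by (auto simp: agreeD)
        have "best s3 (?S d) = best s2 (?S d)" by (rule best_cong) (use ag3 in \<open>auto simp: agreeD\<close>)
        then have best3: "best s3 (?S d)" using best2 by simp
        show ?case
        proof (rule runs_Seq_le[OF witness_block_prog_correct[OF r3 w3 d z3], where
            T' = "M * (12 * m + 37) + 2"], goal_cases)
          case (2 s4)
          then have b4: "\<And>e. e < M \<Longrightarrow> last_hit m (word_arr s4 3 e) (d div m * m + e div m) (d mod m * m + e mod m)"
            and ag4: "agree (witness_block_prog p) s3 s4" by auto
          have r4: "ready s4" using r3 ag4 by (rule ready_agree) (use notw in auto)
          have w4: "word s4 20 = d div m" "word s4 21 = d mod m"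
            using w3 ag4 by (auto simp: agreeD)
          have "best s4 (?S d) = best s3 (?S d)" by (rule best_cong) (use ag4 in \<open>auto simp: agreeD\<close>)
          then have best4: "best s4 (?S d)" using best3 by simp
          let ?B = "\<lambda>e. {cell d e' | e'. e' < e} \<union> ?S d"
          have "runs w V (For 15 7 pair_prog) s4 (M * (12 * m + 37) + 2)
            (\<lambda>s'. best s' (?B M) \<and> agree (For 15 7 pair_prog) s4 s')"
          proof (rule runs_For[where T = "12 * m + 35" and N = M and I = "\<lambda>e s'. best s' (?B e)"], goal_cases)
            case (8 e x s5)
            then show ?case by (simp add: best_def)
          next
            case (9 e s5)
            have r5: "ready s5" using r4 9(4) by (rule ready_agree) auto
            have w5: "word s5 20 = d div m" "word s5 21 = d mod m" "word_arr s5 3 = word_arr s4 3"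
              using w4 9(4) by (auto simp: agreeD)
            have "?B (Suc e) = insert (cell d e) (?B e)" by (auto simp: less_Suc_eq)
            with pair_prog_correct[OF r5 w5(1,2) 9(3) d 9(1) _ 9(2)] b4[OF 9(1)] w5(3)
            show ?case by (simp add: cell_def)
          qed (use best4 r4 in \<open>auto simp: size_bounds loadedD readyD\<close>)
          then show ?case
          proof (rule runs_mono, goal_cases)
            case (2 s')
            moreover have "?B M = ?S (Suc d)" by (auto simp: less_Suc_eq)
            ultimately show ?case by simp
          qed simp
        qed simp_all
      qed simp
    qed simp_all
  qed (use s in \<open>auto simp: size_bounds loadedD readyD best_def mod_prog_not_written[OF arith]\<close>)
  then show ?thesis by (rule runs_mono) auto
qed

lemma max_triangle_prog_correct:
  assumes s: "encodes_graph s n E wt" and least: "\<And>k. n \<le> k * k \<Longrightarrow> m \<le> k"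
  shows "runs w V (max_triangle_prog p) s (m ^ 3 * Tm + 200 * m ^ 5)
    (\<lambda>s'. reports_max_triangle s' E wt)"
proof -
  let ?U = "M * (m * (Tm + 37 * M + 9) + M * (12 * m + 37) + M * 3 + 11) + 2"
  let ?S = "{cell d e | d e. d < M \<and> e < M}"
  have "runs w V (max_triangle_prog p) s
    ((3 * m + 7) + ((n * (n * 8 + 6) + 2) + ((M * M * 15 + 2) + (1 + (?U + 1)))))
    (\<lambda>s'. reports_max_triangle s' E wt)"
    unfolding max_triangle_prog_def
  proof (rule runs_Seq_le[OF init_prog_correct[OF s least], where
        T' = "(n * (n * 8 + 6) + 2) + ((M * M * 15 + 2) + (1 + (?U + 1)))"], assumption, rule runs_Seq_le)
    fix s1 assume l1: "loaded s1"
    show "runs w V sort_prog s1 (n * (n * 8 + 6) + 2)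
      (\<lambda>s'. (\<forall>i<n. word_arr s' 1 i = vertex_at n wt i) \<and> agree sort_prog s1 s')"
      using l1 size_bounds by (intro sort_prog_correct) (auto simp: loaded_def)
    fix s2 assume 2: "(\<forall>i<n. word_arr s2 1 i = vertex_at n wt i) \<and> agree sort_prog s1 s2"
    then have l2: "loaded s2"
      using loaded_agree[OF l1, of sort_prog s2] by (simp add: sort_prog_def compare_prog_def)
    show "runs w V (Seq matrix_prog (Seq (WConst 22 0) (Seq (search_prog p) (WOp WAdd 0 22 5)))) s2
      ((M * M * 15 + 2) + (1 + (?U + 1))) (\<lambda>s'. reports_max_triangle s' E wt)"
    proof (rule runs_Seq_le[OF matrix_prog_correct[OF l2]])
      fix s3 assume 3: "ready s3 \<and> agree matrix_prog s2 s3"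
      show "runs w V (Seq (WConst 22 0) (Seq (search_prog p) (WOp WAdd 0 22 5))) s3
        (1 + (?U + 1)) (\<lambda>s'. reports_max_triangle s' E wt)"
      proof (rule runs_Seq_le)
        show "runs w V (WConst 22 0) s3 1 (\<lambda>s4. s4 = set_word 22 0 s3)"
          by (rule runs_wp_le) auto
        fix s4 assume 4: "s4 = set_word 22 0 s3"
        have r4: "ready s4" using 3 by (simp add: 4 ready_def loaded_def)
        have "word s4 22 = 0" using 4 by simp
        from runs_agree[OF search_prog_correct[OF r4 this]]
        show "runs w V (Seq (search_prog p) (WOp WAdd 0 22 5)) s4 (?U + 1)
          (\<lambda>s'. reports_max_triangle s' E wt)"
        proof (rule runs_Seq_le)
          fix s5 assume 5: "best s5 ?S \<and> agree (search_prog p) s4 s5"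
          have "word s5 5 = word s4 5"
            using 5 mod_prog_not_written[OF arith]
            by (auto intro!: agreeD(1) simp: search_prog_def)
          then have [simp]: "word s5 5 = 0" using r4 by (simp add: ready_def loaded_def)
          have best: "word s5 22 = 1 \<and> triangle_weight wt x y z \<le> val s5 3" if t: "triangle E x y z" for x y z
          proof -
            have less: "x < n" "y < n" "z < n"
              using t E by (auto simp: triangle_def simple_graph_def)
            let ?r = "rank n wt"
            have "adj (?r x) (?r y)" "adj (?r x) (?r z)" "adj (?r y) (?r z)"
              using t less by (auto simp: adj_def triangle_def rank_less vertex_at_rank)
            moreover have "?r x < M" "?r y < M"
              using rank_less less nM by (meson less_le_trans)+
            \<comment> \<open>All ordered pairs of positions have been treated, so the triangle is
              covered whatever the order of its vertices.\<close>
            then have "(?r x, ?r y) \<in> ?S" using all_cells by fastforce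
            ultimately have "word s5 22 = 1 \<and>
                weight_at (?r x) + weight_at (?r y) + weight_at (?r z) \<le> val s5 3"
              using 5 unfolding best_def by blast
            then show ?thesis
              using less by (simp add: weight_at_def vertex_at_rank triangle_weight_def)
          qed
          have bit: "word s5 22 = 0 \<or> word s5 22 = 1 \<and> triangle E (word s5 1) (word s5 2) (word s5 3) \<and>
              val s5 3 = triangle_weight wt (word s5 1) (word s5 2) (word s5 3)"
            using 5 by (simp add: best_def)
          then have "reports_max_triangle (set_word 0 (word s5 22) s5) E wt"
            using best by (fastforce simp: reports_max_triangle_def max_triangle_def)
          moreover have "word s5 22 < 2 ^ w" using bit size_bounds(6) by auto
          ultimately show "runs w V (WOp WAdd 0 22 5) s5 1 (\<lambda>s'. reports_max_triangle s' E wt)"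
            by (intro runs_wp_le) auto
        qed simp
      qed simp
    qed (use 2 in simp_all)
  qed simp_all
  moreover have "(3 * m + 7) + ((n * (n * 8 + 6) + 2) + ((M * M * 15 + 2) + (1 + (?U + 1)))) \<le>
    m ^ 3 * Tm + 200 * m ^ 5"
  proof -
    have nn: "n * (n * 8 + 6) \<le> M * (M * 8 + 6)" using nM by (intro mult_le_mono) auto
    have pow: "m ^ k \<le> m ^ 5" if "k \<le> 5" for k using m that by (intro power_increasing) auto
    have "(3 * m + 7) + ((M * (M * 8 + 6) + 2) + ((M * M * 15 + 2) + (1 + (?U + 1)))) =
      m ^ 3 * Tm + 49 * m ^ 5 + 63 * m ^ 4 + 9 * m ^ 3 + 17 * m ^ 2 + 3 * m ^ 1 + 15 * m ^ 0"
      by (simp add: M algebra_simps power_numeral_reduce)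
    \<comment> \<open>Every power is at most m^5, and the coefficients besides that of the products
      add up to 156.\<close>
    also have "\<dots> \<le> m ^ 3 * Tm + 200 * m ^ 5"
      using pow[of 4] pow[of 3] pow[of 2] pow[of 1] pow[of 0] by linarith
    finally show ?thesis using nn by linarith
  qed
  ultimately show ?thesis by (rule runs_mono) auto
qed

end

section \<open>Bit lengths\<close>

lemma values_of_lengthI:
  assumes "\<bar>x\<bar> < 2 ^ i" "x * 2 ^ f \<in> \<int>" "1 + i + f \<le> w"
  shows "x \<in> values_of_length w"
proof -
  have "(LEAST k. \<bar>x\<bar> < 2 ^ k) \<le> i" "(LEAST k. x * 2 ^ k \<in> \<int>) \<le> f"
    using assms by (auto intro: Least_le)
  then show ?thesis
    using assms by (auto simp: values_of_length_def finite_binary_def num_bits_def)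
qed

lemma num_bitsD:
  assumes "finite_binary x" "num_bits x \<le> Suc b"
  shows "\<bar>x\<bar> < 2 ^ b" "x * 2 ^ b \<in> \<int>"
proof -
  define i where "i = (LEAST k. \<bar>x\<bar> < 2 ^ k)"
  define f where "f = (LEAST k. x * 2 ^ k \<in> \<int>)"
  have "\<exists>k. \<bar>x\<bar> < 2 ^ k" by (rule real_arch_pow) simp
  then have i: "\<bar>x\<bar> < 2 ^ i" unfolding i_def by (rule LeastI_ex)
  have f: "x * 2 ^ f \<in> \<int>" using assms(1) unfolding f_def finite_binary_def by (rule LeastI_ex)
  have le: "i \<le> b" "f \<le> b" using assms(2) by (auto simp: num_bits_def i_def f_def)
  have "(2::real) ^ i \<le> 2 ^ b" using le by (intro power_increasing) auto
  then show "\<bar>x\<bar> < 2 ^ b" using i by linarith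
  have "x * 2 ^ b = x * 2 ^ f * of_int (2 ^ (b - f))"
    using le by (simp flip: power_add)
  then show "x * 2 ^ b \<in> \<int>" using f by (metis Ints_mult Ints_of_int)
qed

text \<open>With B = b + 1, the one bit beyond b being the sign, both parts of a summand have at
  most b bits. A sum of three needs two more integer bits and no more fractional bits: 1 + (b + 2) +
  b = 2 * B + 1.\<close>

lemma num_bits_sum:
  assumes "finite_binary x" "finite_binary y" "finite_binary z"
    and "num_bits x \<le> B" "num_bits y \<le> B" "num_bits z \<le> B" "2 * B + 1 \<le> w"
  shows "x + y \<in> values_of_length w" "x + y + z \<in> values_of_length w"
proof -
  obtain b where b: "B = Suc b" using assms(4) by (cases B) (auto simp: num_bits_def)
  note bits = num_bitsD[OF assms(1) assms(4)[unfolded b]] num_bitsD[OF assms(2) assms(5)[unfolded b]]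
    num_bitsD[OF assms(3) assms(6)[unfolded b]]
  show "x + y + z \<in> values_of_length w"
  proof (rule values_of_lengthI)
    show "\<bar>x + y + z\<bar> < 2 ^ (b + 2)" using bits by (simp add: power_add)
    show "(x + y + z) * 2 ^ b \<in> \<int>" using bits by (simp add: distrib_right)
  qed (use assms b in simp)
  show "x + y \<in> values_of_length w"
  proof (rule values_of_lengthI)
    show "\<bar>x + y\<bar> < 2 ^ (b + 2)" using bits by (simp add: power_add)
    show "(x + y) * 2 ^ b \<in> \<int>" using bits by (simp add: distrib_right)
  qed (use assms b in simp)
qed

section \<open>Running time\<close>

lemma least_square_root:
  fixes n :: nat
  assumes "n \<ge> 1"
  obtains m where "1 \<le> m" "m \<le> n" "n \<le> m * m" "\<forall>k. n \<le> k * k \<longrightarrow> m \<le> k" "m * m \<le> 4 * n"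
proof -
  define m where "m = (LEAST k. n \<le> k * k)"
  have nn: "n \<le> n * n" by simp
  have 1: "n \<le> m * m" unfolding m_def by (rule LeastI[of "\<lambda>k. n \<le> k * k", OF nn])
  have 2: "m \<le> k" if "n \<le> k * k" for k unfolding m_def using that by (rule Least_le)
  have m: "1 \<le> m" using 1 assms by (cases m) auto
  have "m * m \<le> 4 * n"
  proof (cases "m = 1")
    case False
    then obtain k where k: "m = Suc k" "1 \<le> k" using m by (cases m) auto
    \<comment> \<open>By minimality m - 1 is too small, and m is at most twice as large.\<close>
    then have "k * k < n" using 2[of k] by force
    moreover have "m * m \<le> (2 * k) * (2 * k)" using k by (intro mult_le_mono) auto
    ultimately show ?thesis by simp
  qed (use assms in simp)
  then show ?thesis using that m 1 2 nn by blast
qed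

lemma max_bits_ge_1: "n \<ge> 1 \<Longrightarrow> 1 \<le> max_bits n wt"
proof -
  assume "n \<ge> 1"
  then have "num_bits (wt 0) \<le> max_bits n wt" unfolding max_bits_def by (intro Max_ge) auto
  then show ?thesis by (simp add: num_bits_def)
qed

lemma power_bound_of_log:
  assumes "real w \<ge> real k * log 2 (real n + 1)"
  shows "(n + 1) ^ k \<le> 2 ^ w"
proof -
  have "(real n + 1) powr real k = 2 powr (real k * log 2 (real n + 1))"
    by (subst mult.commute, subst powr_powr[symmetric]) simp
  also have "\<dots> \<le> 2 powr real w" using assms by simp
  finally have "(real n + 1) ^ k \<le> 2 ^ w" by (simp add: powr_realpow)
  then have "real ((n + 1) ^ k) \<le> real (2 ^ w)" by (simp add: add.commute)
  then show ?thesis by (simp only: of_nat_le_iff)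
qed

text \<open>The common core of both claims, free of any factor that depends on the weights. The sign
  of C is recorded because the bound is to be multiplied by such a factor later.\<close>

lemma max_triangle_finite_binary:
  assumes "matrix_mult_exponent \<omega>"
  obtains p c C where "C \<ge> 0"
    and "\<And>n E wt w s. \<lbrakk>n \<ge> 1; simple_graph n E; finite_binary_weights n wt;
      real w \<ge> c * (real (max_bits n wt) + log 2 (real n + 1)); encodes_graph s n E wt\<rbrakk> \<Longrightarrow>
      \<exists>t s'. exec w (values_of_length w) p s t s' \<and> real t \<le> C * real n powr ((\<omega> + 3) / 2) \<and>
        reports_max_triangle s' E wt"
proof (rule mod_matrix_mult[OF assms], goal_cases)
  case (1 p c Tm C)
  note p = 1(2) and Tm = 1(3) and mult = 1(4)
  have \<omega>: "\<omega> \<ge> 2" using assms by (rule matrix_mult_exponent_ge_2)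
  \<comment> \<open>The 200 is the overhead of order m^5, and the power of 4 comes from m * m \<le>
    4 * n.\<close>
  define D where "D = (\<bar>C\<bar> + 200) * 4 powr ((\<omega> + 3) / 2)"
  show ?case
  \<comment> \<open>The 7 serves two purposes: it makes 2^w at least (n + 1)^7, which exceeds 4 *
    (m^2 + 2)^2, and it leaves 2 * B + 1 bits for sums of three weights.\<close>
  proof (rule that[of D "max c 7" "max_triangle_prog p"])
    fix n w :: nat and E wt and s :: state
    assume n: "n \<ge> 1" and E: "simple_graph n E" and wt: "finite_binary_weights n wt"
      and w: "real w \<ge> max c 7 * (real (max_bits n wt) + log 2 (real n + 1))"
      and s: "encodes_graph s n E wt"
    obtain m where root: "1 \<le> m" "m \<le> n" "n \<le> m * m" "\<forall>k. n \<le> k * k \<longrightarrow> m \<le> k" "m * m \<le> 4 * n"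
      by (rule least_square_root[OF n])
    let ?B = "max_bits n wt" and ?L = "log 2 (real n + 1)"
    have L: "?L \<ge> 0" by simp
    have "7 * (real ?B + ?L) \<le> max c 7 * (real ?B + ?L)" using L by (intro mult_right_mono) auto
    then have w7: "7 * real ?B + 7 * ?L \<le> real w" using w by (simp add: distrib_left)
    have "(n + 1) ^ 7 \<le> 2 ^ w" using w7 by (intro power_bound_of_log) simp
    moreover have "4 * ((m * m + 2) * (m * m + 2)) < (n + 1) ^ 7"
    proof -
      have "m * m \<le> n * n" using root by (intro mult_le_mono)
      then have 1: "m * m + 2 \<le> (n + 1) ^ 2" using n by (simp add: power2_eq_square)
      have "4 = (2::nat) ^ 2" by simp
      also have "\<dots> \<le> (n + 1) ^ 2" using n by (intro power_mono) auto
      finally have "4 * ((m * m + 2) * (m * m + 2)) \<le> (n + 1) ^ 2 * ((n + 1) ^ 2 * (n + 1) ^ 2)"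
        using 1 by (intro mult_le_mono)
      also have "\<dots> = (n + 1) ^ 6" by (simp flip: power_add)
      also have "\<dots> < (n + 1) ^ 7" using n by (intro power_strict_increasing) auto
      finally show ?thesis .
    qed
    ultimately have wl: "4 * ((m * m + 2) * (m * m + 2)) < 2 ^ w" by linarith
    have B: "num_bits (wt v) \<le> ?B" "finite_binary (wt v)" if "v < n" for v
      using that wt by (auto simp: max_bits_def finite_binary_weights_def intro!: Max_ge)
    have "2 * real ?B + 1 \<le> real w" using w7 L max_bits_ge_1[OF n, of wt] by linarith
    then have Bw: "2 * ?B + 1 \<le> w" by linarith
    interpret blocks n m "m * m" w "values_of_length w" E wt
      using n root E wl num_bits_sum[OF B(2) B(2) B(2) B(1) B(1) B(1) Bw] by unfold_locales auto
    interpret blocks_mult n m "m * m" w "values_of_length w" E wt p "Tm m"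
    proof
      fix A B :: "nat \<Rightarrow> nat \<Rightarrow> nat" and s :: state
      have "log 2 (real m + 1) \<le> ?L" using root(2) by simp
      then have "c * log 2 (real m + 1) \<le> max c 7 * (real ?B + ?L)"
        by (intro mult_mono) (auto simp del: log_le_cancel_iff)
      then have wc: "c * log 2 (real m + 1) \<le> real w" using w by linarith
      have "(m + 1) * (m + 1) \<le> (m * m + 2) * (m * m + 2)" using root by (intro mult_le_mono) auto
      then have "(m + 1) * (m + 1) < 2 ^ w" using wl by linarith
      note mult[OF root(1) wc this]
      then show "\<lbrakk>word s 5 = 0; word s 8 = m + 1; word s 100 = m;
        \<And>i j. i < m \<Longrightarrow> j < m \<Longrightarrow> word_arr s 11 (i * m + j) = A i j \<and> A i j \<le> 1;
        \<And>i j. i < m \<Longrightarrow> j < m \<Longrightarrow> word_arr s 13 (i * m + j) = B i j \<and> B i j \<le> 1\<rbrakk> \<Longrightarrow>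
        runs w (values_of_length w) (mod_prog p) s (Tm m) (\<lambda>s'. \<forall>i<m. \<forall>j<m.
          clip (m + 1) (word_arr s' 15 (i * m + j)) = (\<Sum>k<m. A i k * B k j :: nat))" .
    qed (use p in auto)
    from max_triangle_prog_correct[OF s root(4)[rule_format]] obtain t s' where
      t: "exec w (values_of_length w) (max_triangle_prog p) s t s'"
        "t \<le> m ^ 3 * Tm m + 200 * m ^ 5" "reports_max_triangle s' E wt"
      by (auto simp: runs_def)
    have half: "2 * ((\<omega> + 3) / 2) = \<omega> + 3" by simp
    have mpos: "0 < real m" using root by simp
    have "real t \<le> real (m ^ 3 * Tm m + 200 * m ^ 5)" using t(2) by (simp only: of_nat_le_iff)
    also have "\<dots> = real m ^ 3 * real (Tm m) + 200 * real m ^ 5" by simp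
    also have "\<dots> \<le> real m powr 3 * (\<bar>C\<bar> * real m powr \<omega>) + 200 * real m powr (\<omega> + 3)"
    proof (intro add_mono mult_left_mono)
      have "real (Tm m) \<le> C * real m powr \<omega>" by (rule Tm)
      also have "\<dots> \<le> \<bar>C\<bar> * real m powr \<omega>" by (intro mult_right_mono) auto
      finally show "real m ^ 3 * real (Tm m) \<le> real m powr 3 * (\<bar>C\<bar> * real m powr \<omega>)"
        using mpos by (simp add: powr_numeral mult_left_mono)
      have "real m ^ 5 = real m powr 5" using mpos by (simp add: powr_numeral)
      \<comment> \<open>This is where \<omega> \<ge> 2 enters: the scans are absorbed by the
        products.\<close>
      also have "\<dots> \<le> real m powr (\<omega> + 3)" using root \<omega> by (intro powr_mono) auto
      finally show "real m ^ 5 \<le> real m powr (\<omega> + 3)" .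
    qed simp
    also have "\<dots> = (\<bar>C\<bar> + 200) * real m powr (\<omega> + 3)"
      by (simp add: powr_add algebra_simps)
    \<comment> \<open>Passing to the square of m, which is within a constant factor of n, halves the
      exponent.\<close>
    also have "real m powr (\<omega> + 3) = (real m powr 2) powr ((\<omega> + 3) / 2)"
      unfolding powr_powr half ..
    also have "real m powr 2 = real (m * m)" using mpos by (simp add: powr_numeral power2_eq_square)
    also have "(\<bar>C\<bar> + 200) * real (m * m) powr ((\<omega> + 3) / 2) \<le>
        (\<bar>C\<bar> + 200) * (4 * real n) powr ((\<omega> + 3) / 2)"
    proof (intro mult_left_mono powr_mono2)
      have "real (m * m) \<le> real (4 * n)" using root(5) by (simp only: of_nat_le_iff)
      then show "real (m * m) \<le> 4 * real n" by simp
    qed (use \<omega> in auto)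
    also have "\<dots> = D * real n powr ((\<omega> + 3) / 2)" by (simp add: D_def powr_mult)
    finally show "\<exists>t s'. exec w (values_of_length w) (max_triangle_prog p) s t s' \<and>
        real t \<le> D * real n powr ((\<omega> + 3) / 2) \<and> reports_max_triangle s' E wt"
      using t by blast
  qed (simp add: D_def)
qed

lemma max_triangle_in_time_if:
  assumes "matrix_mult_exponent \<omega>"
    and "\<And>n wt. P n wt \<Longrightarrow> finite_binary_weights n wt"
    and "\<And>n E wt. n \<ge> 1 \<Longrightarrow> g n E wt \<ge> 1"
  shows "max_triangle_in_time P (\<lambda>n E wt. real n powr ((\<omega> + 3) / 2) * g n E wt)"
proof (rule max_triangle_finite_binary[OF assms(1)], goal_cases)
  case (1 p c C)
  note C = 1(1) and p = 1(2)
  show ?case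
    unfolding max_triangle_in_time_def
  proof (rule exI[of _ p], rule exI[of _ c], rule exI[of _ C], intro allI impI)
    fix n E wt w s
    assume *: "n \<ge> 1" "simple_graph n E" "P n wt"
      "real w \<ge> c * (real (max_bits n wt) + log 2 (real n + 1))" "encodes_graph s n E wt"
    from p[OF *(1,2) assms(2)[OF *(3)] *(4,5)] obtain t s' where
      t: "exec w (values_of_length w) p s t s'" "real t \<le> C * real n powr ((\<omega> + 3) / 2)"
        "reports_max_triangle s' E wt" by blast
    note t(2)
    also have "C * real n powr ((\<omega> + 3) / 2) \<le> C * real n powr ((\<omega> + 3) / 2) * g n E wt"
      using C assms(3)[OF *(1)] mult_left_mono[of 1 "g n E wt" "C * real n powr ((\<omega> + 3) / 2)"]
      by simp
    finally show "\<exists>t s'. exec w (values_of_length w) p s t s' \<and>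
        real t \<le> C * (real n powr ((\<omega> + 3) / 2) * g n E wt) \<and> reports_max_triangle s' E wt"
      using t by (auto simp: mult.assoc)
  qed
qed

theorem theorem2p2:
  fixes \<omega> :: real
  assumes "matrix_mult_exponent \<omega>"
  shows "max_triangle_in_time integer_weights
           (\<lambda>n E wt. real n powr ((\<omega> + 3) / 2) * log_weight (max_triangle_weight E wt))
       \<and> max_triangle_in_time finite_binary_weights
           (\<lambda>n E wt. real n powr ((\<omega> + 3) / 2) * real (max_bits n wt))"
proof
  have "finite_binary x" if "x \<in> \<int>" for x
    unfolding finite_binary_def using that by (intro exI[of _ 0]) simp
  then show "max_triangle_in_time integer_weights
      (\<lambda>n E wt. real n powr ((\<omega> + 3) / 2) * log_weight (max_triangle_weight E wt))"
    by (intro max_triangle_in_time_if assms)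
      (auto simp: integer_weights_def finite_binary_weights_def log_weight_def le_log_iff)
  show "max_triangle_in_time finite_binary_weights
      (\<lambda>n E wt. real n powr ((\<omega> + 3) / 2) * real (max_bits n wt))"
    using max_bits_ge_1 by (intro max_triangle_in_time_if assms) (auto simp: Suc_le_eq)
qed

end
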